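(* Let $f(z)=z+\sum_{n=2}^{\infty}a_nz^n\in\mathcal{C}_1$. Then $$|f(z)|+|f'(z)||z|+\sum_{n=2}^{\infty}|a_nz^n|\le d(f(0),\partial f(\mathbb{D}))$$ for $|z|\le r_{11}$, where $r_{11}\approx 0.110377$ is the solution in $(0,1)$ of $$\log 2-1-r\bigl(-6+r(2+r-\log 2)+\log 4\bigr)+2(1-r)^2\log(1-r)=0.$$ The result is sharp, i.e. $r_{11}$ cannot be replaced by any larger number such that the inequality still holds for all $f\in\mathcal{C}_1$.
   Context: $\mathbb{D}=\{z\in\mathbb{C}:|z|<1\}$; $d$ is the Euclidean distance and $\partial f(\mathbb{D})$ is the boundary of $f(\mathbb{D})$. A convex function is a univalent analytic function on $\mathbb{D}$ whose image is a convex domain. The class $\mathcal{C}_1$ consists of the analytic functions $f(z)=z+\sum_{n=2}^\infty a_nz^n$ on $\mathbb{D}$ for which there exists a convex function $g(z)=b_1z+\cdots$ with $\operatorname{Re}(b_1)>0$ such that $\operatorname{Re}\left(\frac{zf'(z)}{g(z)}\right)>0$ for all $z\in\mathbb{D}$ (the quotient being extended analytically to $z=0$). *)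

theory Defs
  imports "HOL-Complex_Analysis.Complex_Analysis"
begin

abbreviation unit_disc :: "complex set" where
  "unit_disc \<equiv> ball 0 1"

definition convex_function :: "(complex \<Rightarrow> complex) \<Rightarrow> bool" where
  "convex_function g \<longleftrightarrow>
     g holomorphic_on unit_disc \<and> inj_on g unit_disc \<and> convex (g ` unit_disc)"

text \<open>
  The function \<open>p\<close> below is the analytic extension to \<open>0\<close> of the quotient
  \<open>z f'(z) / g(z)\<close>; since \<open>g\<close> is univalent with \<open>g(0) = 0\<close>, the denominator does not
  vanish elsewhere in the disc. Only the values of \<open>f\<close> and \<open>g\<close> on the unit disc matter.
\<close>

definition class_C1 :: "(complex \<Rightarrow> complex) set" where
  "class_C1 = {f.
     f holomorphic_on unit_disc \<and> f 0 = 0 \<and> deriv f 0 = 1 \<and>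
     (\<exists>g. convex_function g \<and> g 0 = 0 \<and> Re (deriv g 0) > 0 \<and>
       (\<exists>p. p holomorphic_on unit_disc \<and>
            (\<forall>z\<in>unit_disc - {0}. p z = z * deriv f z / g z) \<and>
            (\<forall>z\<in>unit_disc. Re (p z) > 0)))}"

definition taylor_coeff :: "(complex \<Rightarrow> complex) \<Rightarrow> nat \<Rightarrow> complex" where
  "taylor_coeff f n = fps_nth (fps_expansion f 0) n"

text \<open>
  For \<open>f\<close> holomorphic on the unit disc and \<open>z\<close> in it, the series converges (absolute
  convergence of the Taylor series).
\<close>

definition bohr_sum :: "(complex \<Rightarrow> complex) \<Rightarrow> complex \<Rightarrow> real" where
  "bohr_sum f z = norm (f z) + norm (deriv f z) * norm z
     + (\<Sum>n. norm (taylor_coeff f (n + 2) * z ^ (n + 2)))"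

definition r11_equation :: "real \<Rightarrow> bool" where
  "r11_equation r \<longleftrightarrow>
     ln 2 - 1 - r * (- 6 + r * (2 + r - ln 2) + ln 4) + 2 * (1 - r)\<^sup>2 * ln (1 - r) = 0"

end

theory Submission
  imports Defs
begin

text \<open>
  For convex \<open>g\<close> with \<open>g 0 = 0\<close>, Schwarz's lemma applied to \<open>z \<mapsto> g\<^sup>-\<^sup>1 ((1 - t) g z + t g (a z))\<close>
  gives \<open>Re ((g z - g (a z)) / (z g' z)) \<ge> 0\<close> for \<open>norm a \<le> 1\<close>; the maximum principle in \<open>a\<close>
  sharpens the case \<open>a = 0\<close> to \<open>Re (z g' / g) \<ge> 1/2\<close>. This yields the coefficient and growth bounds
  of \<open>M = g / z\<close>. Since \<open>f' = p M\<close> with \<open>Re p > 0\<close>, Caratheodory's inequality gives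
  \<open>norm a\<^sub>n \<le> 2 - 1/n\<close> and \<open>(1 - r) / (1 + r)\<^sup>2 \<le> norm f' \<le> (1 + r) / (1 - r)\<^sup>2\<close>.
  As \<open>f\<close> is close-to-convex it is univalent, so pulling back the segment from \<open>0\<close> to the nearest
  boundary point shows that \<open>f\<close> covers the disc whose radius \<open>1 - ln 2\<close> is the integral of
  \<open>(1 - t) / (1 + t)\<^sup>2\<close> over \<open>[0, 1]\<close>. All the estimates are attained simultaneously by
  \<open>f z = 2 z / (1 - z) + ln (1 - z)\<close>, which comes from \<open>g z = z / (1 - z)\<close> and
  \<open>p z = (1 + z) / (1 - z)\<close>.
\<close>

lemma holomorphic_on_compose_image:
  assumes "f holomorphic_on S" "g holomorphic_on T" "\<And>z. z \<in> S \<Longrightarrow> f z \<in> T"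
  shows "(\<lambda>z. g (f z)) holomorphic_on S"
  using holomorphic_on_compose_gen[OF assms(1,2)] assms(3) by (auto simp: o_def)

section \<open>Functions with nonnegative real part\<close>

text \<open>
  \<open>Re p\<close> is integrated over the circle of radius \<open>r\<close> against the nonnegative weight
  \<open>2 - 2 Re (u cis (n t))\<close>, where \<open>norm u = 1\<close>: only \<open>p 0\<close> and the \<open>n\<close>-th coefficient survive.
\<close>

lemma caratheodory_coeff_bound:
  assumes p: "p holomorphic_on ball 0 1" and pos: "\<And>z. norm z < 1 \<Longrightarrow> Re (p z) \<ge> 0" and "n > 0"
  shows "norm (fps_nth (fps_expansion p 0) n) \<le> 2 * Re (p 0)"
proof -
  define c where "c = fps_nth (fps_expansion p 0) n"
  have *: "r ^ n * norm c \<le> 2 * Re (p 0)" if r: "0 < r" "r < 1" for r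
  proof -
    define P where "P t = p (r * cis t)" for t
    have hol: "p holomorphic_on ball 0 r" and cont: "continuous_on (cball 0 r) p"
      using r by (auto intro!: holomorphic_on_imp_continuous_on holomorphic_on_subset[OF p])
    have polar: "((\<lambda>t. F (r * cis t) * r * \<i> * cis t) has_integral I) {0..2*pi}"
      if "(F has_contour_integral I) (circlepath 0 r)" for F :: "complex \<Rightarrow> complex" and I
      using that unfolding circlepath_def by (simp add: has_contour_integral_part_circlepath_iff)
    have i1: "((\<lambda>t. \<i> * P t) has_integral 2 * pi * \<i> * p 0) {0..2*pi}"
      using polar[OF Cauchy_has_contour_integral_higher_derivative_circlepath[OF cont hol, of 0 0]] r
      by (simp add: P_def mult_ac)
    have "((\<lambda>t. P t / (r * cis t) ^ Suc n * r * \<i> * cis t) has_integral 2 * pi * \<i> * c) {0..2*pi}"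
      using polar[OF Cauchy_has_contour_integral_higher_derivative_circlepath[OF cont hol, of 0 n]] r
      by (simp add: P_def c_def fps_expansion_def)
    moreover have "P t / (r * cis t) ^ Suc n * r * \<i> * cis t = \<i> * P t * (inverse (cis t)) ^ n / r ^ n" for t
      using r by (simp add: field_simps)
    ultimately have i2: "((\<lambda>t. \<i> * P t * inverse (cis t) ^ n / r ^ n) has_integral 2 * pi * \<i> * c) {0..2*pi}"
      by (simp only:)
    \<comment> \<open>The frequency \<open>-n\<close> of \<open>P\<close> integrates to zero because
      \<open>p z * z ^ (n - 1)\<close> is holomorphic; \<open>n > 0\<close> keeps the exponent from
      being truncated.\<close>
    have "((\<lambda>z. p z * z ^ (n - 1)) has_contour_integral 0) (circlepath 0 r)"
      using r by (intro Cauchy_theorem_disc_simple[of _ 0 1] holomorphic_intros p) auto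
    then have "((\<lambda>t. P t * (r * cis t) ^ (n - 1) * r * \<i> * cis t) has_integral 0) {0..2*pi}"
      using polar by (fastforce simp: P_def)
    moreover have "P t * (r * cis t) ^ (n - 1) * r * \<i> * cis t = \<i> * P t * cis t ^ n * r ^ n" for t
      using \<open>n > 0\<close> by (cases n) (simp_all add: field_simps)
    ultimately have i3: "((\<lambda>t. \<i> * P t * cis t ^ n * r ^ n) has_integral 0) {0..2*pi}"
      by (simp only:)
    \<comment> \<open>The phase \<open>u\<close> rotates \<open>c\<close> onto the nonnegative axis:
      \<open>cnj u * c = norm c\<close>. Since the weight is 2 - u cis(nt) - cnj u cis(-nt), the
      three integrals combine to 2 pi (2 p(0) - r^n |c|).\<close>
    define u where "u = cis (Arg c)"
    have "c = norm c * u"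
      using rcis_cmod_Arg[of c] by (simp add: rcis_def u_def)
    moreover have "cnj u * u = 1"
      by (simp add: u_def cis_cnj cis_mult del: cis_inverse)
    ultimately have u: "norm u = 1" "cnj u * c = norm c"
      by (auto simp: u_def, metis mult.left_commute mult.right_neutral)
    have "((\<lambda>t. (2 * (\<i> * P t) - u * (\<i> * P t * cis t ^ n * r ^ n) / r ^ n - 
             cnj u * r ^ n * (\<i> * P t * inverse (cis t) ^ n / r ^ n)) / \<i>) has_integral 
            (2 * (2 * pi * \<i> * p 0) - u * 0 / r ^ n - cnj u * r ^ n * (2 * pi * \<i> * c)) / \<i>) {0..2*pi}"
      by (intro has_integral_diff has_integral_divide has_integral_mult_right i1 i2 i3)
    moreover have "(2 * (\<i> * P t) - u * (\<i> * P t * cis t ^ n * r ^ n) / r ^ n - 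
             cnj u * r ^ n * (\<i> * P t * inverse (cis t) ^ n / r ^ n)) / \<i> = 
          of_real (2 - 2 * Re (u * cis t ^ n)) * P t" for t
    proof -
      have "of_real (2 - 2 * Re w) = 2 - w - cnj w" for w
        by (simp add: complex_eq_iff)
      then have "of_real (2 - 2 * Re (u * cis t ^ n)) = 2 - u * cis t ^ n - cnj (u * cis t ^ n)"
        .
      also have "cnj (u * cis t ^ n) = cnj u * inverse (cis t) ^ n"
        by (simp add: cis_cnj)
      finally have e: "of_real (2 - 2 * Re (u * cis t ^ n)) = 2 - u * cis t ^ n - cnj u * inverse (cis t) ^ n" .
      show ?thesis unfolding e using r by (simp add: field_simps)
    qed
    ultimately have "((\<lambda>t. of_real (2 - 2 * Re (u * cis t ^ n)) * P t) has_integral 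
            (2 * (2 * pi * \<i> * p 0) - u * 0 / r ^ n - cnj u * r ^ n * (2 * pi * \<i> * c)) / \<i>) {0..2*pi}"
      by simp
    also have "(2 * (2 * pi * \<i> * p 0) - u * 0 / r ^ n - cnj u * r ^ n * (2 * pi * \<i> * c)) / \<i> 
       = of_real (2 * pi) * (2 * p 0 - of_real (r ^ n * norm c))"
      using u(2) by (simp add: field_simps)
    finally have "((\<lambda>t. Re (of_real (2 - 2 * Re (u * cis t ^ n)) * P t)) has_integral
        Re (of_real (2 * pi) * (2 * p 0 - of_real (r ^ n * norm c)))) {0..2*pi}"
      by (rule has_integral_Re)
    moreover have "Re (of_real (2 - 2 * Re (u * cis t ^ n)) * P t) \<ge> 0" for t
    proof -
      have "Re (u * cis t ^ n) \<le> 1"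
        using complex_Re_le_cmod[of "u * cis t ^ n"] u(1) by (simp add: norm_mult norm_power)
      moreover have "Re (P t) \<ge> 0"
        unfolding P_def using r by (intro pos) (simp add: norm_mult)
      ultimately show ?thesis by simp
    qed
    ultimately have "Re (of_real (2 * pi) * (2 * p 0 - of_real (r ^ n * norm c))) \<ge> 0"
      by (rule has_integral_nonneg)
    then show ?thesis using pi_gt_zero by (simp add: zero_le_mult_iff)
  qed
  have "((\<lambda>r. r ^ n * norm c) \<longlongrightarrow> 1 ^ n * norm c) (at_left (1::real))"
    by (intro tendsto_intros)
  moreover have "\<forall>\<^sub>F r in at_left 1. r ^ n * norm c \<le> 2 * Re (p 0)"
    using eventually_at_left_real[of 0 "1::real", OF zero_less_one] by (rule eventually_mono) (use * in auto)
  ultimately show ?thesis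
    unfolding c_def[symmetric] by (intro tendsto_upperbound[where F = "at_left (1::real)" and f = "\<lambda>r. r ^ n * norm c"]) auto
qed

section \<open>Convex functions\<close>

lemma convex_function_deriv_nonzero:
  assumes "convex_function g" "norm z < 1"
  shows "deriv g z \<noteq> 0"
proof -
  obtain k where "\<And>z. z \<in> unit_disc \<Longrightarrow> deriv g z * deriv k (g z) = 1"
    using assms holomorphic_has_inverse[of g unit_disc] unfolding convex_function_def by (metis open_ball)
  then show ?thesis using assms(2) by (metis mem_ball_0 mult_zero_left zero_neq_one)
qed

lemma convex_function_nonzero:
  assumes "convex_function g" "g 0 = 0" "norm z < 1" "z \<noteq> 0"
  shows "g z \<noteq> 0"
  using assms unfolding convex_function_def inj_on_def
  by (metis centre_in_ball mem_ball_0 zero_less_one)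

text \<open>For t in [0,1] the map \<open>w \<mapsto> k (h t w)\<close> is a self-map of the disc
  fixing 0, so \<open>norm (k (h t z)) \<le> norm z\<close>, with equality at t = 0. Hence
  \<open>m\<close> is largest on [0,1] at t = 0, and its derivative there,
  \<open>Re (cnj z * v)\<close>, cannot be positive. For z = 0 the quotient is 0 by the convention
  on division.\<close>

lemma convex_function_variation:
  assumes g: "convex_function g" "g 0 = 0" and z: "norm z < 1" and a: "norm a \<le> 1"
  shows "Re ((g z - g (a * z)) / (z * deriv g z)) \<ge> 0"
proof (cases "z = 0")
  case False
  have hol: "g holomorphic_on unit_disc" and inj: "inj_on g unit_disc" and conv: "convex (g ` unit_disc)"
    using g unfolding convex_function_def by auto
  obtain k where k: "k holomorphic_on (g ` unit_disc)"
      "\<And>z. z \<in> unit_disc \<Longrightarrow> deriv g z * deriv k (g z) = 1"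
      "\<And>z. z \<in> unit_disc \<Longrightarrow> k (g z) = z"
    using holomorphic_has_inverse[OF hol open_ball inj] by metis
  have op: "open (g ` unit_disc)"
    using open_mapping_thm3[OF hol open_ball inj] .
  have az: "norm (a * w) < 1" if "norm w < 1" for w
    using mult_left_le_one_le[of "norm w" "norm a"] a that by (simp add: norm_mult)
  define h where "h t w = g w + of_real t * (g (a * w) - g w)" for t w
  have h_in: "h t w \<in> g ` unit_disc" if "t \<in> {0..1}" "norm w < 1" for t w
  proof -
    have "(1 - t) *\<^sub>R g w + t *\<^sub>R g (a * w) \<in> g ` unit_disc"
      using that az[OF that(2)] by (intro convexD_alt[OF conv]) auto
    then show ?thesis by (simp add: h_def scaleR_conv_of_real algebra_simps)
  qed
  have hol_a: "(\<lambda>w. g (a * w)) holomorphic_on unit_disc"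
    by (rule holomorphic_on_compose_image[OF _ hol]) (use az in \<open>auto intro!: holomorphic_intros\<close>)
  have contr: "norm (k (h t z)) \<le> norm z" if t: "t \<in> {0..1}" for t
  proof (rule Schwarz_Lemma(1)[of "\<lambda>w. k (h t w)"])
    have "h t holomorphic_on unit_disc"
      unfolding h_def by (intro holomorphic_intros hol hol_a)
    then show "(\<lambda>w. k (h t w)) holomorphic_on unit_disc"
      by (rule holomorphic_on_compose_image[OF _ k(1)]) (use h_in[OF t] in auto)
    show "k (h t 0) = 0"
      using k(3)[of 0] g(2) by (simp add: h_def)
    show "norm (k (h t w)) < 1" if "norm w < 1" for w
      using h_in[OF t that] k(3) by auto
  qed (use z in auto)
  define v where "v = (g (a * z) - g z) / deriv g z"
  define m where "m t = Re (cnj z * k (h t z))" for t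
  have "(k has_field_derivative deriv k (g z)) (at (h 0 z))"
    using holomorphic_derivI[OF k(1) op] z by (simp add: h_def)
  moreover have "((\<lambda>t. h t z) has_vector_derivative (g (a * z) - g z)) (at 0)"
    unfolding h_def by (auto intro!: derivative_eq_intros)
  ultimately have "((\<lambda>t. k (h t z)) has_vector_derivative (g (a * z) - g z) * deriv k (g z)) (at 0)"
    by (rule field_vector_diff_chain_at[of "\<lambda>t. h t z" _ 0 k, unfolded o_def, rotated])
  also have "(g (a * z) - g z) * deriv k (g z) = v"
    using k(2)[of z] z convex_function_deriv_nonzero[OF g(1) z] by (simp add: v_def field_simps)
  finally have "((\<lambda>t. cnj z * k (h t z)) has_vector_derivative cnj z * v) (at 0)"
    by (rule has_vector_derivative_mult_right)
  then have m': "(m has_real_derivative Re (cnj z * v)) (at 0)"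
    unfolding m_def has_real_derivative_iff_has_vector_derivative
    by (rule bounded_linear.has_vector_derivative[OF bounded_linear_Re])
  have m_le: "m t \<le> m 0" if "t \<in> {0..1}" for t
  proof -
    have "m t \<le> norm (cnj z * k (h t z))" unfolding m_def by (rule complex_Re_le_cmod)
    also have "\<dots> \<le> norm z * norm z"
      using contr[OF that] by (simp add: norm_mult mult_left_mono)
    also have "\<dots> = m 0"
      using k(3)[of z] z by (simp add: m_def h_def cmod_power2[unfolded power2_eq_square])
    finally show ?thesis .
  qed
  have "Re (cnj z * v) \<le> 0"
  proof (rule ccontr)
    assume "\<not> ?thesis"
    with DERIV_pos_inc_right[OF m'] obtain d where d: "d > 0" "\<And>h. 0 < h \<Longrightarrow> h < d \<Longrightarrow> m 0 < m (0 + h)"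
      by auto
    show False using d(2)[of "min (d/2) 1"] d(1) m_le[of "min (d/2) 1"] by (auto simp: min_less_iff_disj)
  qed
  moreover have "(g z - g (a * z)) / (z * deriv g z) = - (cnj z * v) / of_real ((norm z)\<^sup>2)"
    using False convex_function_deriv_nonzero[OF g(1) z]
    by (simp add: v_def complex_norm_square field_simps del: of_real_power)
  ultimately show ?thesis
    by (simp only: Re_divide_of_real) (simp add: zero_le_divide_iff)
qed auto

lemma Re_cayley_sphere:
  assumes "norm a = 1"
  shows "Re ((1 + a) / (1 - a)) = 0"
  using assms cmod_power2[of a] by (simp add: Re_divide power2_eq_square algebra_simps)

text \<open>
  On the circle \<open>norm a = 1\<close> the term \<open>(1 + a) / (1 - a)\<close> is imaginary, and subtracting it cancels
  the pole of \<open>2 z g' z / (g z - g (a z))\<close> at \<open>a = 1\<close>.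
\<close>

lemma convex_function_starlike_half:
  assumes g: "convex_function g" "g 0 = 0" and z: "norm z < 1" "z \<noteq> 0"
  shows "Re (z * deriv g z / g z) \<ge> 1 / 2"
proof -
  have hol: "g holomorphic_on unit_disc" and inj: "inj_on g unit_disc"
    using g unfolding convex_function_def by auto
  \<comment> \<open>The radius exceeds 1, so a = 1 is an interior point of the domain of
    \<open>a \<mapsto> g (a * z)\<close> and the singularities there are removable.\<close>
  define S where "S = ball (0::complex) (1 / norm z)"
  have S: "open S" "1 \<in> S" "0 \<in> S" "cball 0 1 \<subseteq> S"
  proof -
    have "1 < 1 / norm z" using z by simp
    then show "open S" "1 \<in> S" "0 \<in> S" "cball 0 1 \<subseteq> S" by (auto simp: S_def)
  qed
  have Sz: "norm (a * z) < 1" if "a \<in> S" for a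
    using that z by (auto simp: S_def norm_mult field_simps)
  define A where "A a = g (a * z)" for a
  have A_hol: "A holomorphic_on S"
    unfolding A_def
    by (rule holomorphic_on_compose_image[OF _ hol]) (use Sz in \<open>auto intro!: holomorphic_intros\<close>)
  define c where "c = z * deriv g z"
  have c: "c \<noteq> 0" using convex_function_deriv_nonzero[OF g(1) z(1)] z by (simp add: c_def)
  have "(A has_field_derivative c) (at 1)"
  proof -
    have "(g has_field_derivative deriv g z) (at (1 * z))"
      using holomorphic_derivI[OF hol open_ball] z by simp
    then have "((\<lambda>a. g (a * z)) has_field_derivative deriv g z * z) (at 1)"
      by (rule DERIV_chain2) (auto intro!: derivative_eq_intros)
    then show ?thesis unfolding A_def[abs_def] c_def by (simp add: mult.commute)
  qed
  then have dA: "deriv A 1 = c" by (rule DERIV_imp_deriv)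
  define D where "D a = (if a = 1 then deriv A 1 else (A a - A 1) / (a - 1))" for a
  have D_hol: "D holomorphic_on S"
    unfolding D_def by (rule pole_lemma_open[OF A_hol S(1)])
  have A_ne: "A a \<noteq> A 1" if "a \<in> S" "a \<noteq> 1" for a
    using inj_onD[OF inj, of "a * z" "1 * z"] that Sz[OF that(1)] z by (auto simp: A_def)
  have D_nz: "D a \<noteq> 0" if "a \<in> S" for a
    using A_ne[OF that] c dA by (auto simp: D_def)
  \<comment> \<open>As \<open>D 1 = c\<close>, \<open>N\<close> vanishes at 1. Its difference
    quotient \<open>\<Psi>\<close> is therefore holomorphic on \<open>S\<close>, and away from 1 it
    is the Cayley term minus \<open>2 * (c / (A 1 - A a))\<close>.\<close>
  define N where "N a = 2 * c / D a - (1 + a)" for a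
  have N_hol: "N holomorphic_on S"
    unfolding N_def by (intro holomorphic_intros D_hol D_nz)
  have N1: "N 1 = 0" using c by (simp add: N_def D_def dA)
  define \<Psi> where "\<Psi> a = (if a = 1 then deriv N 1 else (N a - N 1) / (a - 1))" for a
  have \<Psi>_hol: "\<Psi> holomorphic_on S"
    unfolding \<Psi>_def by (rule pole_lemma_open[OF N_hol S(1)])
  have \<Psi>_eq: "\<Psi> a = (1 + a) / (1 - a) - 2 * (c / (A 1 - A a))" if "a \<in> S" "a \<noteq> 1" for a
    using A_ne[OF that] that(2) N1
    by (simp add: \<Psi>_def N_def D_def divide_simps) (simp add: algebra_simps)
  have le1: "Re (\<Psi> a) \<le> 0" if a: "norm a = 1" "a \<noteq> 1" for a
  proof -
    have "Re ((A 1 - A a) / c) \<ge> 0"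
      using convex_function_variation[OF g z(1), of a] a by (simp add: A_def c_def)
    moreover have "Re (inverse x) \<ge> 0" if "Re x \<ge> 0" for x
      using that by simp
    ultimately have "Re (inverse ((A 1 - A a) / c)) \<ge> 0" by blast
    then have "Re (c / (A 1 - A a)) \<ge> 0" by simp
    moreover have "a \<in> S" using S(4) a by auto
    ultimately show ?thesis
      using Re_cayley_sphere[OF a(1)] a(2) by (simp add: \<Psi>_eq del: times_divide_eq_right)
  qed
  have cont: "continuous_on S \<Psi>" using \<Psi>_hol by (rule holomorphic_on_imp_continuous_on)
  \<comment> \<open>At a = 1 both terms of \<open>\<Psi>_eq\<close> are singular, so the bound is
    obtained as a limit along the circle.\<close>
  have "Re (\<Psi> 1) \<le> 0"
  proof (rule tendsto_upperbound)
    have "isCont \<Psi> (cis 0)" using cont S by (simp add: continuous_on_eq_continuous_at)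
    moreover have "((\<lambda>t. cis t) \<longlongrightarrow> cis 0) (at_right 0)"
      unfolding cis_conv_exp by (intro tendsto_intros)
    ultimately have "((\<lambda>t. \<Psi> (cis t)) \<longlongrightarrow> \<Psi> (cis 0)) (at_right 0)"
      by (rule isCont_tendsto_compose)
    then show "((\<lambda>t. Re (\<Psi> (cis t))) \<longlongrightarrow> Re (\<Psi> 1)) (at_right 0)"
      using tendsto_Re by fastforce
    have "Re (\<Psi> (cis t)) \<le> 0" if "t \<in> {0<..<1}" for t :: real
    proof (rule le1)
      have "sin t > 0" using that pi_gt3 by (intro sin_gt_zero) auto
      then show "cis t \<noteq> 1" by (auto simp: complex_eq_iff)
    qed simp
    then show "\<forall>\<^sub>F t in at_right 0. Re (\<Psi> (cis t)) \<le> 0"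
      using eventually_at_right_real[of 0 "1::real"] by (auto elim: eventually_mono)
  qed simp
  then have le: "Re (\<Psi> a) \<le> 0" if "norm a = 1" for a
    using le1 that by metis
  \<comment> \<open>Since \<open>\<Psi> 0 = 1 - 2 * (c / g z)\<close>, this inequality is the
    claim.\<close>
  have "Re (\<Psi> 0) \<le> 0"
  proof (rule maximum_real_frontier[of \<Psi> "ball 0 1"])
    show "\<Psi> holomorphic_on interior (ball 0 1)"
      by (rule holomorphic_on_subset[OF \<Psi>_hol]) (use S(4) in auto)
    show "continuous_on (closure (ball 0 1)) \<Psi>"
      by (rule continuous_on_subset[OF cont]) (use S(4) in auto)
  qed (use le in auto)
  then show ?thesis using S g(2) by (simp add: \<Psi>_eq A_def c_def del: times_divide_eq_right)
qed

section \<open>Schwarz-type estimates and bounds for the quotient g(z)/z\<close>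

lemma Schwarz_Lemma_le:
  assumes "f holomorphic_on ball 0 1" "f 0 = 0" "\<And>z. norm z < 1 \<Longrightarrow> norm (f z) \<le> 1" "norm z < 1"
  shows "norm (f z) \<le> norm z"
proof -
  \<comment> \<open>The factor s < 1 makes the bound on the image strict, as Schwarz's lemma
    requires; afterwards s tends to 1.\<close>
  have "norm (s * f z) \<le> norm z" if s: "0 < s" "s < 1" for s :: real
  proof (rule Schwarz_Lemma(1)[of "\<lambda>w. s * f w"])
    show "norm (s * f w) < 1" if "norm w < 1" for w
    proof -
      have "s * norm (f w) \<le> s * 1" using assms(3)[OF that] s by (intro mult_left_mono) auto
      then have "s * norm (f w) < 1" using s by linarith
      then show ?thesis using s by (simp add: norm_mult)
    qed
  qed (use assms in \<open>auto intro!: holomorphic_intros\<close>)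
  then have *: "s * norm (f z) \<le> norm z" if "s \<in> {0<..<1}" for s
    using that by (force simp: norm_mult)
  have "((\<lambda>s. s * norm (f z)) \<longlongrightarrow> 1 * norm (f z)) (at_left (1::real))"
    by (intro tendsto_intros)
  moreover have "\<forall>\<^sub>F s in at_left 1. s * norm (f z) \<le> norm z"
    using eventually_at_left_real[of 0 "1::real", OF zero_less_one] by (rule eventually_mono) (use * in auto)
  ultimately show ?thesis
    by (intro tendsto_upperbound[where F = "at_left (1::real)" and f = "\<lambda>s. s * norm (f z)"]) auto
qed

text \<open>The map w/(1 + w) sends the half-plane Re w \<ge> -1/2 into the closed unit disc and
  fixes 0, so Schwarz's lemma gives |k/(1 + k)| \<le> |z|; the rest extracts the real part from this
  disc condition.\<close>

lemma half_plane_lower_bound: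
  assumes "k holomorphic_on ball 0 1" "k 0 = 0" "\<And>z. norm z < 1 \<Longrightarrow> Re (k z) \<ge> - 1 / 2" "norm z < 1"
  shows "Re (k z) \<ge> - norm z / (1 + norm z)"
proof -
  have le: "norm (k w) \<le> norm (1 + k w)" and nz: "1 + k w \<noteq> 0" if "norm w < 1" for w
  proof -
    have "(norm (k w))\<^sup>2 \<le> (norm (1 + k w))\<^sup>2"
      unfolding cmod_power2 using assms(3)[OF that] by (simp add: power2_eq_square algebra_simps)
    then show "norm (k w) \<le> norm (1 + k w)" by (rule power2_le_imp_le) simp
    have "Re (1 + k w) \<noteq> 0" using assms(3)[OF that] by simp
    then show "1 + k w \<noteq> 0" by force
  qed
  have "norm (k z / (1 + k z)) \<le> norm z"
  proof (rule Schwarz_Lemma_le[where f = "\<lambda>w. k w / (1 + k w)"])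
    show "(\<lambda>w. k w / (1 + k w)) holomorphic_on unit_disc"
      using nz by (intro holomorphic_intros assms) auto
  qed (use assms le in \<open>auto simp: norm_divide divide_le_eq_1\<close>)
  then have "norm (k z) \<le> norm z * norm (1 + k z)"
    using nz[OF assms(4)] by (simp add: norm_divide divide_le_eq)
  then have "(norm (k z))\<^sup>2 \<le> (norm z)\<^sup>2 * (norm (1 + k z))\<^sup>2"
    by (metis power_mono norm_ge_zero power_mult_distrib)
  moreover define r x y where "r = norm z" and "x = 1 + Re (k z)" and "y = Im (k z)"
  ultimately have "(x - 1)\<^sup>2 + y\<^sup>2 \<le> r\<^sup>2 * (x\<^sup>2 + y\<^sup>2)"
    by (simp add: cmod_power2)
  moreover have r: "0 \<le> r" "r < 1" using assms(4) by (auto simp: r_def)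
  moreover have "r\<^sup>2 * y\<^sup>2 \<le> y\<^sup>2"
    using r by (intro mult_left_le_one_le) (auto simp: power_le_one)
  \<comment> \<open>This is (x - 1)^2 \<le> r^2 x^2 in factored form. The first factor is the larger
    one, so it cannot be negative.\<close>
  ultimately have "((1 + r) * x - 1) * ((1 - r) * x - 1) \<le> 0"
    by (simp add: algebra_simps power2_eq_square)
  moreover have "x \<ge> 1/2" using assms(3)[OF assms(4)] by (simp add: x_def)
  moreover have "(1 - r) * x \<le> (1 + r) * x" using r \<open>x \<ge> 1/2\<close> by (intro mult_right_mono) auto
  ultimately have "(1 + r) * x \<ge> 1"
    by (smt (verit) mult_neg_neg)
  then show ?thesis using r by (simp add: x_def r_def[symmetric] field_simps)
qed

text \<open>\<open>M\<close> is g(z)/z with the singularity removed, and k = z M'/M = z g'/g - 1, so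
  the bound on \<open>Re (k z)\<close> is starlikeness of order 1/2. The relations are in product
  form so that they also hold at 0.\<close>

lemma convex_function_quotient:
  assumes g: "convex_function g" "g 0 = 0"
  obtains M k where "M holomorphic_on unit_disc" "k holomorphic_on unit_disc" "k 0 = 0" "M 0 = deriv g 0"
    "\<And>z. norm z < 1 \<Longrightarrow> g z = z * M z" "\<And>z. norm z < 1 \<Longrightarrow> M z \<noteq> 0"
    "\<And>z. norm z < 1 \<Longrightarrow> z * deriv M z = k z * M z"
    "\<And>z. norm z < 1 \<Longrightarrow> z * deriv g z = (1 + k z) * g z"
    "\<And>z. norm z < 1 \<Longrightarrow> Re (k z) \<ge> - 1 / 2"
proof -
  have hol: "g holomorphic_on unit_disc" using g unfolding convex_function_def by auto
  define M where "M z = (if z = 0 then deriv g 0 else (g z - g 0) / (z - 0))" for z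
  define k where "k z = z * deriv M z / M z" for z
  have M: "M holomorphic_on unit_disc"
    unfolding M_def by (rule pole_lemma_open[OF hol open_ball])
  have gM: "g z = z * M z" for z using g by (simp add: M_def)
  have nz: "M z \<noteq> 0" if "norm z < 1" for z
    using convex_function_nonzero[OF g that] convex_function_deriv_nonzero[OF g(1), of 0] g(2)
    by (auto simp: M_def)
  have k: "k holomorphic_on unit_disc"
    unfolding k_def using nz by (intro holomorphic_intros M holomorphic_deriv) auto
  have zM: "z * deriv M z = k z * M z" if "norm z < 1" for z
    using nz[OF that] by (simp add: k_def)
  have dg: "z * deriv g z = (1 + k z) * g z" if z: "norm z < 1" for z
  proof -
    have "((\<lambda>z. z * M z) has_field_derivative 1 * M z + deriv M z * z) (at z)"
      by (intro DERIV_mult DERIV_ident holomorphic_derivI[OF M open_ball]) (use z in simp)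
    moreover have "(\<lambda>z. z * M z) = g" using gM by auto
    ultimately have "deriv g z = M z + z * deriv M z" by (simp add: DERIV_imp_deriv)
    then show ?thesis using zM[OF z] gM[of z] by (simp add: algebra_simps)
  qed
  have re: "Re (k z) \<ge> - 1 / 2" if z: "norm z < 1" for z
  proof (cases "z = 0")
    case False
    then have "z * deriv g z / g z = 1 + k z"
      using dg[OF z] convex_function_nonzero[OF g z] by simp
    then show ?thesis using convex_function_starlike_half[OF g z False] by simp
  qed (simp add: k_def)
  show ?thesis
    by (rule that[of M k]) (use M k gM nz zM dg re in \<open>auto simp: k_def M_def\<close>)
qed

lemma fps_expansion_disc:
  assumes "f holomorphic_on unit_disc"
  shows "f has_fps_expansion fps_expansion f 0"
    and "norm z < 1 \<Longrightarrow> (\<lambda>n. fps_nth (fps_expansion f 0) n * z ^ n) sums f z"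
  using has_fps_expansion_fps_expansion[OF open_ball _ assms]
    has_fps_expansion_imp_sums_complex[of f "fps_expansion f 0" 1 z] assms
  by (auto simp: one_ereal_def)

text \<open>The function 1 + 2 k has nonnegative real part and value 1 at 0, so the coefficients of
  \<open>k\<close> have modulus at most 1. Comparing coefficients in z M' = k M gives n M_n = k_1
  M_(n-1) + ... + k_n M_0, and strong induction concludes.\<close>

lemma starlike_quotient_coeff_bound:
  assumes M: "M holomorphic_on unit_disc" and k: "k holomorphic_on unit_disc" "k 0 = 0"
    and eq: "\<And>z. norm z < 1 \<Longrightarrow> z * deriv M z = k z * M z"
    and re: "\<And>z. norm z < 1 \<Longrightarrow> Re (k z) \<ge> - 1 / 2"
  shows "norm (fps_nth (fps_expansion M 0) n) \<le> norm (M 0)"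
proof -
  define F K where "F = fps_expansion M 0" and "K = fps_expansion k 0"
  have F: "M has_fps_expansion F" and K: "k has_fps_expansion K"
    unfolding F_def K_def using M k by (auto intro: fps_expansion_disc)
  have K0: "fps_nth K 0 = 0" using k(2) by (simp add: K_def fps_expansion_def)
  have Kn: "norm (fps_nth K n) \<le> 1" if "n > 0" for n
  proof -
    have "(\<lambda>z. 1 + 2 * k z) has_fps_expansion 1 + fps_const 2 * K"
      using K by (auto intro!: fps_expansion_intros)
    then have "fps_expansion (\<lambda>z. 1 + 2 * k z) 0 = 1 + fps_const 2 * K" by (rule fps_expansion_eqI)
    moreover have "Re (1 + 2 * k z) \<ge> 0" if "norm z < 1" for z
      using re[OF that] by simp
    then have "norm (fps_nth (fps_expansion (\<lambda>z. 1 + 2 * k z) 0) n) \<le> 2 * Re (1 + 2 * k 0)"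
      using that by (intro caratheodory_coeff_bound holomorphic_intros k(1)) auto
    ultimately show ?thesis
      using that k(2) by (simp add: norm_mult)
  qed
  have "(\<lambda>z. z * deriv M z) has_fps_expansion fps_X * fps_deriv F"
    using F by (intro fps_expansion_intros)
  moreover have "(\<lambda>z. k z * M z) has_fps_expansion K * F"
    using F K by (intro fps_expansion_intros)
  moreover have "\<forall>\<^sub>F z in nhds 0. k z * M z = z * deriv M z"
    using eventually_nhds_in_open[of unit_disc 0] by (auto elim!: eventually_mono simp: eq)
  ultimately have ser: "fps_X * fps_deriv F = K * F"
    by (metis fps_expansion_unique_complex has_fps_expansion_cong)
  have "norm (fps_nth F n) \<le> norm (M 0)" for n
  proof (induction n rule: less_induct)
    case (less n)
    show ?case
    proof (cases "n = 0")
      case False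
      have "fps_nth (fps_X * fps_deriv F) n = of_nat n * fps_nth F n"
        using False by simp
      then have "of_nat n * fps_nth F n = (\<Sum>i=0..n. fps_nth K i * fps_nth F (n - i))"
        by (simp add: ser fps_mult_nth)
      also have "\<dots> = (\<Sum>i=1..n. fps_nth K i * fps_nth F (n - i))"
        by (simp add: sum.atLeast_Suc_atMost K0)
      finally have "real n * norm (fps_nth F n) = norm (\<Sum>i=1..n. fps_nth K i * fps_nth F (n - i))"
        by (metis norm_mult norm_of_nat)
      also have "\<dots> \<le> (\<Sum>i=1..n. 1 * norm (M 0))"
        by (rule order.trans[OF norm_sum], rule sum_mono, unfold norm_mult, rule mult_mono)
           (use Kn less in auto)
      finally show ?thesis using False by simp
    qed (simp add: F_def fps_expansion_def)
  qed
  then show ?thesis by (simp add: F_def)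
qed

text \<open>On the ray t z with r = |z|, the quantity |M(t z)| (1 + t r) has logarithmic derivative
  Re k(t z)/t + r/(1 + t r), which \<open>half_plane_lower_bound\<close> makes nonnegative. The
  claim compares t = 0 with t = 1; the proof differentiates the squared norm.\<close>

lemma starlike_quotient_growth:
  assumes M: "M holomorphic_on unit_disc" "\<And>z. norm z < 1 \<Longrightarrow> M z \<noteq> 0"
    and k: "k holomorphic_on unit_disc" "k 0 = 0"
    and eq: "\<And>z. norm z < 1 \<Longrightarrow> z * deriv M z = k z * M z"
    and re: "\<And>z. norm z < 1 \<Longrightarrow> Re (k z) \<ge> - 1 / 2"
    and z: "norm z < 1"
  shows "norm (M 0) \<le> norm (M z) * (1 + norm z)"
proof -
  define r where "r = norm z"
  define m where "m t = M (t * z) * (1 + t * r)" for t :: real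
  have tz: "norm (t * z) < 1" if "t \<in> {0..1}" for t :: real
    using that z mult_left_le_one_le[of "norm z" t] by (simp add: norm_mult)
  have m': "(m has_vector_derivative z * deriv M (t * z) * (1 + t * r) + M (t * z) * r) (at t)"
    if "t \<in> {0..1}" for t
  proof -
    have "(M has_field_derivative deriv M (t * z)) (at (t * z))"
      using tz[OF that] by (intro holomorphic_derivI[OF M(1) open_ball]) simp
    moreover have "((\<lambda>t. of_real t * z) has_vector_derivative z) (at t)"
      by (auto intro!: derivative_eq_intros)
    ultimately have d: "((\<lambda>t. M (of_real t * z)) has_vector_derivative z * deriv M (t * z)) (at t)"
      using field_vector_diff_chain_at[of "\<lambda>t. of_real t * z" z t M] by (simp add: o_def)
    have "((\<lambda>t. complex_of_real (1 + t * r)) has_vector_derivative of_real r) (at t)"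
      by (rule has_vector_derivative_of_real) (auto intro!: derivative_eq_intros)
    from has_vector_derivative_mult[OF d this] show ?thesis
      unfolding m_def by (rule has_vector_derivative_eq_rhs) simp
  qed
  have "inner (m 0) (m 0) \<le> inner (m 1) (m 1)"
  proof (rule DERIV_nonneg_imp_increasing_open[where f = "\<lambda>t. inner (m t) (m t)" and a = 0 and b = 1])
    have "continuous_on {0..1} m"
      using has_vector_derivative_continuous[OF m'] by (auto intro: continuous_at_imp_continuous_on)
    then show "continuous_on {0..1} (\<lambda>t. inner (m t) (m t))"
      by (intro continuous_intros)
    fix t :: real assume t: "0 < t" "t < 1"
    then have t': "t \<in> {0..1}" by simp
    define v where "v = z * deriv M (t * z) * (1 + t * r) + M (t * z) * r"
    have "((\<lambda>t. inner (m t) (m t)) has_real_derivative 2 * inner (m t) v) (at t)"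
      using has_derivative_inner[OF m'[OF t', unfolded has_vector_derivative_def]
             m'[OF t', unfolded has_vector_derivative_def]]
      unfolding has_field_derivative_def v_def
      by (rule has_derivative_eq_rhs) (auto simp: inner_commute algebra_simps)
    moreover have "inner (m t) v \<ge> 0"
    proof -
      have r: "1 + t * r > 0" using t by (simp add: r_def add_pos_nonneg)
      have "Re (k (t * z)) \<ge> - norm (t * z) / (1 + norm (t * z))"
        by (intro half_plane_lower_bound k re tz t')
      then have nonneg: "Re (k (t * z)) * (1 + t * r) + t * r \<ge> 0"
        using r t by (simp add: norm_mult r_def[symmetric] field_simps)
      \<comment> \<open>Multiplication by t > 0 produces t z M'(t z), which equals k(t z) M(t z),
        and does not affect the sign.\<close>
      have "of_real t * v = M (t * z) * (k (t * z) * (1 + t * r) + t * r)"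
        using eq[OF tz[OF t']] by (simp add: v_def algebra_simps)
      then have "t * inner (m t) v = 
            inner (M (t * z) * (1 + t * r)) (M (t * z) * (k (t * z) * (1 + t * r) + t * r))"
        by (metis m_def inner_scaleR_right scaleR_conv_of_real)
      also have "\<dots> = (norm (M (t * z)))\<^sup>2 * (1 + t * r) * (Re (k (t * z)) * (1 + t * r) + t * r)"
        by (simp add: inner_complex_def cmod_power2) (simp add: power2_eq_square algebra_simps)
      finally have "t * inner (m t) v \<ge> 0"
        using r nonneg by simp
      then show ?thesis using t by (simp add: zero_le_mult_iff)
    qed
    ultimately show "\<exists>y. ((\<lambda>t. inner (m t) (m t)) has_real_derivative y) (at t) \<and> 0 \<le> y"
      by (intro exI[of _ "2 * inner (m t) v"]) auto
  qed simp
  then have "norm (m 0) \<le> norm (m 1)"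
    by (simp add: norm_le)
  moreover have "norm (1 + complex_of_real r) = 1 + r"
    by (metis abs_of_nonneg add_nonneg_nonneg norm_ge_zero norm_of_real of_real_1 of_real_add r_def zero_le_one)
  ultimately show ?thesis by (simp add: m_def norm_mult r_def)
qed

text \<open>The coefficient bounds sum to |q(0)| (1 + 2r + 2r^2 + ...) = |q(0)| (1 + r)/(1 - r) with
  r = |z|. In \<open>b\<close> the subtraction at n = 0 accounts for the constant term, which enters
  once and not twice.\<close>

lemma caratheodory_growth:
  assumes q: "q holomorphic_on unit_disc" and pos: "\<And>z. norm z < 1 \<Longrightarrow> Re (q z) \<ge> 0" and z: "norm z < 1"
  shows "norm (q z) \<le> norm (q 0) * (1 + norm z) / (1 - norm z)"
proof -
  define c where "c n = fps_nth (fps_expansion q 0) n" for n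
  have c0: "c 0 = q 0" by (simp add: c_def fps_expansion_def)
  have cn: "norm (c n) \<le> 2 * norm (q 0)" if "n > 0" for n
    using caratheodory_coeff_bound[OF q pos that] complex_Re_le_cmod[of "q 0"] by (simp add: c_def)
  define b where "b n = 2 * norm (q 0) * norm z ^ n - (if n = 0 then norm (q 0) else 0)" for n
  have "b sums (2 * norm (q 0) * (1 / (1 - norm z)) - norm (q 0))"
    unfolding b_def using z sums_single[of 0 "\<lambda>_. norm (q 0)"]
    by (intro sums_diff sums_mult geometric_sums) auto
  moreover have le: "norm (c n * z ^ n) \<le> b n" for n
    using cn[of n] c0 by (cases "n = 0") (auto simp: b_def norm_mult norm_power mult_right_mono)
  moreover have "(\<lambda>n. c n * z ^ n) sums q z"
    unfolding c_def by (rule fps_expansion_disc(2)[OF q z])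
  ultimately have "norm (q z) \<le> 2 * norm (q 0) * (1 / (1 - norm z)) - norm (q 0)"
    by (metis sums_unique norm_suminf_le sums_summable)
  also have "\<dots> = norm (q 0) * (1 + norm z) / (1 - norm z)"
    using z by (simp add: field_simps)
  finally show ?thesis .
qed

section \<open>Univalence\<close>

text \<open>The diagonal value makes this jointly continuous for holomorphic \<open>f\<close>, so
  that "critical point" and "two points with the same image" become one closed condition, the
  vanishing of this function.\<close>

definition divided_difference :: "(complex \<Rightarrow> complex) \<Rightarrow> complex \<Rightarrow> complex \<Rightarrow> complex" where
  "divided_difference f z w = (if z = w then deriv f z else (f z - f w) / (z - w))"

text \<open>Only points (a, a) are delicate. There the mean value estimate is applied to f(x) -
  f'(a) x on a ball where f' is within e/2 of f'(a).\<close>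

lemma continuous_on_divided_difference:
  assumes f: "f holomorphic_on S" and S: "open S"
  shows "continuous_on (S \<times> S) (\<lambda>(z, w). divided_difference f z w)"
  unfolding continuous_on_eq_continuous_at[OF open_Times[OF S S]]
proof
  fix p assume "p \<in> S \<times> S"
  then obtain a b where p: "p = (a, b)" "a \<in> S" "b \<in> S" by auto
  have cf: "continuous_on S f" using f by (rule holomorphic_on_imp_continuous_on)
  show "isCont (\<lambda>(z, w). divided_difference f z w) p"
  proof (cases "a = b")
    case False
    define U where "U = (S \<times> S) \<inter> {q. fst q \<noteq> snd q}"
    have "open {q :: complex \<times> complex. fst q \<noteq> snd q}"
      by (intro open_Collect_neq continuous_intros)
    then have U: "open U" "p \<in> U"
      using S p False by (auto simp: U_def open_Times)
    have "continuous_on U (\<lambda>q. (f (fst q) - f (snd q)) / (fst q - snd q))"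
      by (intro continuous_intros continuous_on_compose2[OF cf]) (auto simp: U_def)
    then have "continuous_on U (\<lambda>(z, w). divided_difference f z w)"
      by (rule continuous_on_eq) (auto simp: U_def divided_difference_def)
    then show ?thesis using U by (simp add: continuous_on_eq_continuous_at)
  next
    case True
    have "\<exists>d>0. \<forall>q. dist q p < d \<longrightarrow> dist (case q of (z, w) \<Rightarrow> divided_difference f z w) (deriv f a) < e"
      if e: "e > 0" for e
    proof -
      have "continuous_on S (deriv f)"
        by (intro holomorphic_on_imp_continuous_on holomorphic_deriv f S)
      then have "isCont (deriv f) a" using p S by (simp add: continuous_on_eq_continuous_at)
      then obtain d1 where d1: "d1 > 0" "\<And>x. dist x a < d1 \<Longrightarrow> dist (deriv f x) (deriv f a) < e / 2"
        using e unfolding continuous_at_eps_delta by (meson half_gt_zero)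
      obtain d2 where d2: "d2 > 0" "ball a d2 \<subseteq> S" using S p by (meson openE)
      define d where "d = min d1 d2"
      have d: "d > 0" "ball a d \<subseteq> S" using d1 d2 by (auto simp: d_def)
      have bd: "dist (divided_difference f z w) (deriv f a) < e" if zw: "z \<in> ball a d" "w \<in> ball a d" for z w
      proof (cases "z = w")
        case True
        then show ?thesis using d1(2)[of z] zw e by (auto simp: divided_difference_def d_def dist_commute)
      next
        case False
        have "norm ((f z - deriv f a * z) - (f w - deriv f a * w)) \<le> e / 2 * norm (z - w)"
        proof (rule field_differentiable_bound[of "ball a d"])
          fix x assume x: "x \<in> ball a d"
          show "((\<lambda>x. f x - deriv f a * x) has_field_derivative (deriv f x - deriv f a * 1)) (at x within ball a d)"
            using x d by (intro DERIV_diff DERIV_cmult DERIV_ident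
                has_field_derivative_at_within[OF holomorphic_derivI[OF f S]]) auto
          show "norm (deriv f x - deriv f a * 1) \<le> e / 2"
            using d1(2)[of x] x by (simp add: d_def dist_norm norm_minus_commute)
        qed (use zw in auto)
        moreover have "divided_difference f z w - deriv f a = 
              ((f z - deriv f a * z) - (f w - deriv f a * w)) / (z - w)"
          using False by (simp add: divided_difference_def field_simps)
        ultimately have "norm (divided_difference f z w - deriv f a) \<le> e / 2"
          using False by (simp add: norm_divide divide_le_eq)
        then show ?thesis using e by (simp add: dist_norm)
      qed
      have "dist (case q of (z, w) \<Rightarrow> divided_difference f z w) (deriv f a) < e" if q: "dist q p < d" for q
      proof -
        have "fst q \<in> ball a d" "snd q \<in> ball a d"
          using q dist_fst_le[of q p] dist_snd_le[of q p] p True by (auto simp: dist_commute)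
        then show ?thesis using bd by (simp add: case_prod_beta)
      qed
      then show ?thesis using d(1) by blast
    qed
    then show ?thesis
      using p True by (simp add: continuous_at_eps_delta divided_difference_def)
  qed
qed

text \<open>The local inverse \<open>k\<close> of \<open>X\<close> satisfies k(X(0) + s)/s
  \<rightarrow> 1 as s decreases to 0. So u = k(X(0) + s) points almost along the positive axis, and
  multiplication by \<open>a\<close> or \<open>b\<close> keeps it in the right half-plane for small
  s.\<close>

lemma local_inverse_nonneg_direction:
  assumes X: "X holomorphic_on U" "open U" "0 \<in> U" and d: "deriv X 0 = 1"
    and ab: "Re a > 0" "Re b > 0"
  obtains s :: real and u where "s > 0" "u \<in> U" "X u = X 0 + s" "Re (a * u) \<ge> 0" "Re (b * u) \<ge> 0"
proof -
  obtain r where r: "r > 0" "ball 0 r \<subseteq> U" "open (X ` ball 0 r)" "inj_on X (ball 0 r)"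
    using has_complex_derivative_locally_invertible[OF X(1,3,2)] d by force
  have Xr: "X holomorphic_on ball 0 r" using X(1) r(2) by (rule holomorphic_on_subset)
  obtain k where k: "k holomorphic_on (X ` ball 0 r)"
     "\<And>z. z \<in> ball 0 r \<Longrightarrow> deriv X z * deriv k (X z) = 1" "\<And>z. z \<in> ball 0 r \<Longrightarrow> k (X z) = z"
    using holomorphic_has_inverse[OF Xr open_ball r(4)] by metis
  have "deriv k (X 0) = 1" using k(2)[of 0] r d by simp
  then have "(k has_field_derivative 1) (at (X 0))"
    using holomorphic_derivI[OF k(1) r(3), of "X 0"] r by simp
  then have "(\<lambda>h. (k (X 0 + h) - k (X 0)) / h) \<midarrow>0\<rightarrow> 1"
    by (simp add: DERIV_def)
  then have "(\<lambda>h. k (X 0 + h) / h) \<midarrow>0\<rightarrow> 1"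
    using k(3)[of 0] r by simp
  moreover have "filterlim (\<lambda>s. complex_of_real s) (at 0) (at_right 0)"
    by (rule filterlim_atI) (auto intro!: tendsto_eq_intros simp: eventually_at_filter)
  ultimately have lim: "((\<lambda>s. k (X 0 + complex_of_real s) / complex_of_real s) \<longlongrightarrow> 1) (at_right 0)"
    by (rule filterlim_compose)
  have pos: "\<forall>\<^sub>F s in at_right 0. Re (c * (k (X 0 + complex_of_real s) / complex_of_real s)) > 0" 
    if "Re c > 0" for c
    using that by (intro order_tendstoD(1)[OF tendsto_Re[OF tendsto_mult[OF tendsto_const lim]]]) auto
  have "X 0 \<in> X ` ball 0 r" using r by auto
  then have "\<forall>\<^sub>F y in nhds (X 0). y \<in> X ` ball 0 r"
    using r(3) by (rule eventually_nhds_in_open[rotated])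
  moreover have "filterlim (\<lambda>s. X 0 + complex_of_real s) (nhds (X 0)) (at_right 0)"
    by (auto intro!: tendsto_eq_intros)
  ultimately have "\<forall>\<^sub>F s in at_right 0. X 0 + complex_of_real s \<in> X ` ball 0 r"
    unfolding filterlim_iff by blast
  moreover have "\<forall>\<^sub>F s in at_right 0. s > (0::real)"
    by (simp add: eventually_at_filter)
  ultimately have "\<forall>\<^sub>F s in at_right 0. X 0 + complex_of_real s \<in> X ` ball 0 r \<and> s > 0 \<and>
      Re (a * (k (X 0 + complex_of_real s) / complex_of_real s)) > 0 \<and>
      Re (b * (k (X 0 + complex_of_real s) / complex_of_real s)) > 0"
    using pos[OF ab(1)] pos[OF ab(2)] by eventually_elim auto
  then obtain s where s: "X 0 + complex_of_real s \<in> X ` ball 0 r" "s > 0"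
      "Re (a * (k (X 0 + complex_of_real s) / complex_of_real s)) > 0"
      "Re (b * (k (X 0 + complex_of_real s) / complex_of_real s)) > 0"
    using eventually_happens by fastforce
  then obtain u where u: "u \<in> ball 0 r" "X 0 + complex_of_real s = X u" by auto
  have "Re (a * u / s) > 0" "Re (b * u / s) > 0" using s(3,4) k(3)[OF u(1)] u(2) by auto
  then show ?thesis
    using that[of s u] s(2) u r(2) by (auto simp: Re_divide_of_real zero_less_divide_iff)
qed

text \<open>
  All convex combinations \<open>(1 - s) f + s g\<close> are locally injective, and \<open>g\<close> is injective. If \<open>f\<close> were
  not injective on a disc \<open>norm z \<le> \<rho>\<close>, there would be a largest \<open>s\<close> for which two points \<open>z \<noteq> w\<close> of
  it have equal images. Moving \<open>z\<close> and \<open>w\<close> inwards along \<open>z exp (- u / \<alpha>)\<close> and \<open>w exp (- u / \<beta>)\<close>,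
  where \<open>\<alpha>\<close> and \<open>\<beta>\<close> are the values of \<open>z (f + T g)' / g\<close> with \<open>T = s / (1 - s)\<close>, then increases \<open>s\<close>.
\<close>

lemma close_to_starlike_injective:
  assumes f: "f holomorphic_on unit_disc" and g: "g holomorphic_on unit_disc" "inj_on g unit_disc" "g 0 = 0"
    and eqf: "\<And>z. norm z < 1 \<Longrightarrow> z * deriv f z = p z * g z"
    and eqg: "\<And>z. norm z < 1 \<Longrightarrow> z * deriv g z = k z * g z"
    and p: "\<And>z. norm z < 1 \<Longrightarrow> Re (p z) > 0" and k: "\<And>z. norm z < 1 \<Longrightarrow> Re (k z) > 0"
    and nz: "deriv g 0 \<noteq> 0" and eq0: "deriv f 0 = p 0 * deriv g 0" "k 0 = 1"
  shows "inj_on f unit_disc"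
proof (rule inj_onI, rule ccontr)
  fix z0 w0 assume z0: "z0 \<in> unit_disc" "w0 \<in> unit_disc" "f z0 = f w0" "z0 \<noteq> w0"
  define \<rho> where "\<rho> = max (norm z0) (norm w0)"
  have \<rho>: "\<rho> < 1" using z0 by (auto simp: \<rho>_def)
  have in_disc: "norm z < 1" if "z \<in> cball 0 \<rho>" for z using that \<rho> by auto
  have g_nz: "g z \<noteq> 0" if "norm z < 1" "z \<noteq> 0" for z
    using inj_onD[OF g(2), of z 0] that g(3) by auto
  define Q where "Q s z w = (1 - of_real s) * divided_difference f z w + of_real s * divided_difference g z w"
    for s :: real and z w
  \<comment> \<open>Up to the factor g(z)/z (\<open>deriv g 0\<close> at the origin),
    \<open>Q s z z\<close> is \<open>(1 - s) * p z + s * k z\<close>, which has positive real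
    part.\<close>
  have Q_diag: "Q s z z \<noteq> 0" if s: "s \<in> {0..1}" and z: "norm z < 1" for s z
  proof -
    have "Re ((1 - of_real s) * p z + of_real s * k z) = (1 - s) * Re (p z) + s * Re (k z)" by simp
    also have "\<dots> > 0"
      using s p[OF z] k[OF z] by (cases "s = 0") (auto intro!: add_nonneg_pos)
    finally have ne: "(1 - of_real s) * p z + of_real s * k z \<noteq> 0" by force
    show ?thesis
    proof (cases "z = 0")
      case True
      then have "Q s z z = ((1 - of_real s) * p z + of_real s * k z) * deriv g 0"
        using eq0 by (simp add: Q_def divided_difference_def algebra_simps)
      then show ?thesis using ne nz by simp
    next
      case False
      have "z * Q s z z = (1 - of_real s) * (z * deriv f z) + of_real s * (z * deriv g z)"
        by (simp add: Q_def divided_difference_def algebra_simps)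
      also have "\<dots> = ((1 - of_real s) * p z + of_real s * k z) * g z"
        by (simp add: eqf[OF z] eqg[OF z] algebra_simps)
      finally show ?thesis using ne g_nz[OF z False] by auto
    qed
  qed
  have Q_iff: "Q s z w = 0 \<longleftrightarrow> (1 - of_real s) * f z + of_real s * g z = (1 - of_real s) * f w + of_real s * g w"
    if "z \<noteq> w" for s z w
  proof -
    have "Q s z w = (((1 - of_real s) * f z + of_real s * g z) - ((1 - of_real s) * f w + of_real s * g w)) / (z - w)"
      using that by (simp add: Q_def divided_difference_def diff_divide_distrib add_divide_distrib algebra_simps)
    then show ?thesis using that by simp
  qed
  \<comment> \<open>Including the diagonal makes \<open>A\<close> compact, so a largest s is
    attained; \<open>Q_diag\<close> ensures that the two points found there are distinct.\<close>
  define A where "A = {q \<in> {0..1} \<times> cball 0 \<rho> \<times> cball 0 \<rho>. Q (fst q) (fst (snd q)) (snd (snd q)) = 0}"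
  have cont: "continuous_on ({0..1::real} \<times> cball 0 \<rho> \<times> cball 0 \<rho>) (\<lambda>q. Q (fst q) (fst (snd q)) (snd (snd q)))"
  proof -
    have "snd ` ({0..1::real} \<times> cball 0 \<rho> \<times> cball 0 \<rho>) \<subseteq> unit_disc \<times> unit_disc"
      using in_disc by auto
    then have "continuous_on ({0..1::real} \<times> cball 0 \<rho> \<times> cball 0 \<rho>) (\<lambda>q. divided_difference h (fst (snd q)) (snd (snd q)))"
      if "h holomorphic_on unit_disc" for h
      using continuous_on_compose2[OF continuous_on_divided_difference[OF that open_ball],
          of "{0..1::real} \<times> cball 0 \<rho> \<times> cball 0 \<rho>" snd]
      by (simp add: case_prod_beta continuous_on_snd)
    then show ?thesis unfolding Q_def using f g(1) by (intro continuous_intros)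
  qed
  have "compact A"
  proof -
    have "closed A"
      unfolding A_def by (intro continuous_closed_preimage_constant cont closed_Times closed_cball closed_atLeastAtMost)
    moreover have "bounded A"
      by (rule bounded_subset[of "{0..1} \<times> cball 0 \<rho> \<times> cball 0 \<rho>"])
        (auto simp: A_def intro!: bounded_Times)
    ultimately show ?thesis by (simp add: compact_eq_bounded_closed)
  qed
  moreover have "(0, z0, w0) \<in> A"
    using z0 Q_iff[of z0 w0 0] by (auto simp: A_def \<rho>_def)
  ultimately have "\<exists>m\<in>A. \<forall>q\<in>A. fst q \<le> fst m"
    by (intro continuous_attains_sup continuous_intros) auto
  then obtain m where m: "m \<in> A" "\<And>q. q \<in> A \<Longrightarrow> fst q \<le> fst m" by blast
  obtain \<sigma> z w where m_eq: "m = (\<sigma>, z, w)" by (cases m)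
  have \<sigma>: "\<sigma> \<in> {0..1}" and zw: "z \<in> cball 0 \<rho>" "w \<in> cball 0 \<rho>" and Q0: "Q \<sigma> z w = 0"
    using m(1) by (auto simp: A_def m_eq)
  have zw': "norm z < 1" "norm w < 1" using zw in_disc by auto
  have ne: "z \<noteq> w" using Q0 Q_diag[OF \<sigma> zw'(1)] by auto
  have g_ne: "g z \<noteq> g w" using inj_onD[OF g(2), of z w] zw' ne by auto
  have \<sigma>1: "\<sigma> < 1"
    using Q0 g_ne \<sigma> unfolding Q_iff[OF ne] by (cases "\<sigma> = 1") auto
  define T where "T = \<sigma> / (1 - \<sigma>)"
  have T: "T \<ge> 0" using \<sigma> \<sigma>1 by (simp add: T_def)
  have fT: "f z + T * g z = f w + T * g w"
  proof -
    have "(1 - of_real \<sigma>) * (f z + T * g z) = (1 - of_real \<sigma>) * f z + of_real \<sigma> * g z" for z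
      using \<sigma>1 by (simp add: T_def field_simps)
    then have "(1 - of_real \<sigma>) * (f z + T * g z) = (1 - of_real \<sigma>) * (f w + T * g w)"
      using Q0 unfolding Q_iff[OF ne] by simp
    moreover have "1 - complex_of_real \<sigma> \<noteq> 0" using \<sigma>1 by (simp add: complex_eq_iff)
    ultimately show ?thesis by simp
  qed
  define \<alpha> \<beta> where "\<alpha> = p z + T * k z" and "\<beta> = p w + T * k w"
  have "Re \<alpha> > 0" "Re \<beta> > 0"
    using add_pos_nonneg[OF p mult_nonneg_nonneg[OF T less_imp_le[OF k]]] zw' by (simp_all add: \<alpha>_def \<beta>_def)
  then have \<alpha>: "Re \<alpha> > 0" "\<alpha> \<noteq> 0" and \<beta>: "Re \<beta> > 0" "\<beta> \<noteq> 0"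
    by force+
  \<comment> \<open>For F = f + T g one has z F'(z) = \<alpha> g(z) and w F'(w) = \<beta> g(w), so
    F(Z u) and F(W u) start with derivatives -g(z) and -g(w) in u.\<close>
  define Z W where "Z u = z * exp (- u / \<alpha>)" and "W u = w * exp (- u / \<beta>)" for u
  have Z0: "Z 0 = z" "W 0 = w" by (auto simp: Z_def W_def)
  have ZW_hol: "Z holomorphic_on UNIV" "W holomorphic_on UNIV"
    unfolding Z_def W_def by (intro holomorphic_intros; use \<alpha> \<beta> in simp)+
  define U0 where "U0 = {u. norm (Z u) < 1} \<inter> {u. norm (W u) < 1}"
  have "open U0"
    unfolding U0_def using ZW_hol
    by (intro open_Int open_Collect_less continuous_intros holomorphic_on_imp_continuous_on)
  have fZ: "(\<lambda>u. h (Z u)) holomorphic_on U0" "(\<lambda>u. h (W u)) holomorphic_on U0" 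
    if "h holomorphic_on unit_disc" for h
    by (rule holomorphic_on_compose_image[OF holomorphic_on_subset[OF ZW_hol(1)] that]
        holomorphic_on_compose_image[OF holomorphic_on_subset[OF ZW_hol(2)] that]; simp add: U0_def)+
  define U where "U = U0 \<inter> (\<lambda>u. g (Z u) - g (W u)) -` (- {0})"
  have "(\<lambda>u. g (Z u) - g (W u)) holomorphic_on U0"
    by (intro holomorphic_intros fZ g(1))
  then have "open U"
    unfolding U_def using \<open>open U0\<close>
    by (intro continuous_open_preimage holomorphic_on_imp_continuous_on) auto
  moreover have "0 \<in> U" using zw' g_ne unfolding U_def U0_def by (simp add: Z0)
  ultimately have U: "open U" "0 \<in> U" by auto
  \<comment> \<open>\<open>X u\<close> is the parameter t for which f + t g takes equal values at
    \<open>Z u\<close> and \<open>W u\<close>. The choice of \<alpha> and \<beta> gives it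
    derivative 1 at 0.\<close>
  define X where "X u = (f (W u) - f (Z u)) / (g (Z u) - g (W u))" for u
  have X_hol: "X holomorphic_on U"
    unfolding X_def using fZ[OF f] fZ[OF g(1)]
    by (intro holomorphic_intros) (auto simp: U_def intro: holomorphic_on_subset)
  have X0: "X 0 = T" using fT g_ne by (simp add: X_def Z0 field_simps)
  have "deriv X 0 = 1"
  proof -
    have dZ: "((\<lambda>u. h (Z u)) has_field_derivative deriv h z * (- z / \<alpha>)) (at 0)" 
      and dW: "((\<lambda>u. h (W u)) has_field_derivative deriv h w * (- w / \<beta>)) (at 0)" 
      if h: "h holomorphic_on unit_disc" for h
    proof -
      have "(Z has_field_derivative - z / \<alpha>) (at 0)" "(W has_field_derivative - w / \<beta>) (at 0)"
        unfolding Z_def W_def using \<alpha> \<beta> by (auto intro!: derivative_eq_intros)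
      moreover have "(h has_field_derivative deriv h z) (at (Z 0))" "(h has_field_derivative deriv h w) (at (W 0))"
        using holomorphic_derivI[OF h open_ball] zw' by (auto simp: Z0)
      ultimately show "((\<lambda>u. h (Z u)) has_field_derivative deriv h z * (- z / \<alpha>)) (at 0)" 
        "((\<lambda>u. h (W u)) has_field_derivative deriv h w * (- w / \<beta>)) (at 0)"
        by (blast intro: DERIV_chain2)+
    qed
    define N' D' where "N' = deriv f w * (- w / \<beta>) - deriv f z * (- z / \<alpha>)"
      and "D' = deriv g z * (- z / \<alpha>) - deriv g w * (- w / \<beta>)"
    have "(X has_field_derivative (N' * (g z - g w) - (f w - f z) * D') / ((g z - g w) * (g z - g w))) (at 0)"
      unfolding X_def N'_def D'_def
      using DERIV_divide[OF DERIV_diff[OF dW[OF f] dZ[OF f]] DERIV_diff[OF dZ[OF g(1)] dW[OF g(1)]]] g_ne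
      by (simp add: Z0)
    moreover have "f w - f z = T * (g z - g w)" using fT by (simp add: algebra_simps)
    moreover have "N' - T * D' = g z - g w"
    proof -
      have "N' - T * D' = (z * deriv f z + T * (z * deriv g z)) / \<alpha> - (w * deriv f w + T * (w * deriv g w)) / \<beta>"
        by (simp add: N'_def D'_def field_simps add_divide_distrib diff_divide_distrib)
      also have "\<dots> = \<alpha> * g z / \<alpha> - \<beta> * g w / \<beta>"
        unfolding eqf[OF zw'(1)] eqf[OF zw'(2)] eqg[OF zw'(1)] eqg[OF zw'(2)]
        by (simp add: \<alpha>_def \<beta>_def algebra_simps)
      finally show ?thesis using \<alpha> \<beta> by simp
    qed
    ultimately have "(X has_field_derivative ((g z - g w) * (g z - g w)) / ((g z - g w) * (g z - g w))) (at 0)"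
      by (metis (no_types, lifting) left_diff_distrib mult.assoc mult.commute)
    then show ?thesis using g_ne by (intro DERIV_imp_deriv) simp
  qed
  moreover have "Re (1 / \<alpha>) > 0" "Re (1 / \<beta>) > 0"
    using \<alpha> \<beta> by (auto simp: Re_divide intro!: divide_pos_pos add_pos_nonneg)
  ultimately obtain s u where su: "s > 0" "u \<in> U" "X u = X 0 + of_real s" 
      "Re (1 / \<alpha> * u) \<ge> 0" "Re (1 / \<beta> * u) \<ge> 0"
    using local_inverse_nonneg_direction[OF X_hol U] by blast
  have "norm (Z u) \<le> norm z" "norm (W u) \<le> norm w"
    using su(4,5) by (auto simp: Z_def W_def norm_mult mult_left_le)
  then have ZW: "Z u \<in> cball 0 \<rho>" "W u \<in> cball 0 \<rho>" using zw by auto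
  have ZWne: "Z u \<noteq> W u" using su(2) by (auto simp: U_def)
  define t where "t = T + s"
  have t: "t > T" using su by (simp add: t_def)
  have "f (W u) - f (Z u) = t * (g (Z u) - g (W u))"
  proof -
    have "X u = of_real t" using su(3) X0 by (simp add: t_def)
    moreover have "g (Z u) - g (W u) \<noteq> 0" using su(2) by (simp add: U_def)
    ultimately show ?thesis unfolding X_def by (simp add: divide_eq_eq)
  qed
  then have "f (Z u) + t * g (Z u) = f (W u) + t * g (W u)" by (simp add: algebra_simps)
  \<comment> \<open>The increasing map t/(1 + t) inverts s/(1 - s), so t > T becomes \<tau> >
    \<sigma>, against maximality.\<close>
  moreover define \<tau> where "\<tau> = t / (1 + t)"
  have "1 + t > 0" using t T by simp
  then have "1 + complex_of_real t \<noteq> 0" by (auto simp: complex_eq_iff)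
  then have "(1 - of_real \<tau>) * f y + of_real \<tau> * g y = (f y + t * g y) / (1 + t)" for y
  proof -
    have "1 - of_real \<tau> = 1 / (1 + complex_of_real t)"
      using \<open>1 + complex_of_real t \<noteq> 0\<close> by (simp add: \<tau>_def field_simps)
    then show ?thesis by (simp add: \<tau>_def add_divide_distrib)
  qed
  ultimately have "Q \<tau> (Z u) (W u) = 0" unfolding Q_iff[OF ZWne] by simp
  moreover have "\<tau> \<in> {0..1}" using t T by (simp add: \<tau>_def)
  ultimately have "(\<tau>, Z u, W u) \<in> A" using ZW by (auto simp: A_def)
  from m(2)[OF this] have "\<tau> \<le> \<sigma>" by (simp add: m_eq)
  moreover have "\<sigma> < \<tau>"
  proof -
    have "\<sigma> = T / (1 + T)" using \<sigma>1 by (simp add: T_def field_simps)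
    also have "\<dots> < t / (1 + t)" using t T by (simp add: field_simps)
    finally show ?thesis by (simp add: \<tau>_def)
  qed
  ultimately show False by simp
qed

section \<open>Covering radius\<close>

text \<open>The function is the primitive, vanishing at 0, of the lower distortion bound; its value
  at 1 is the covering radius 1 - ln 2.\<close>

lemma DERIV_distortion_primitive:
  fixes x :: real
  assumes "x > -1"
  shows "((\<lambda>x. 2 * x / (1 + x) - ln (1 + x)) has_real_derivative (1 - x) / (1 + x)\<^sup>2) (at x)"
proof -
  have "((\<lambda>x. 2 * x / (1 + x) - ln (1 + x)) has_real_derivative
      (2 * (1 + x) - 2 * x) / ((1 + x) * (1 + x)) - 1 / (1 + x)) (at x)"
    using assms by (auto intro!: derivative_eq_intros)
  also have "(2 * (1 + x) - 2 * x) / ((1 + x) * (1 + x)) - 1 / (1 + x) = (1 - x) / (1 + x)\<^sup>2"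
  proof -
    have "1 + x \<noteq> 0" using assms by simp
    then show ?thesis by (simp add: divide_simps) (simp add: power2_eq_square algebra_simps)
  qed
  finally show ?thesis .
qed

text \<open>Let K be the preimage of the segment from 0 to w = f(z). As f'(K) K' = w, the lower
  bound gives L'(|K|) |K'| \<le> |w|, so s |w| - L(|K(s)|) is nondecreasing in s; compare s = 0 with
  s = 1.\<close>

lemma inverse_growth:
  fixes f :: "complex \<Rightarrow> complex"
  assumes f: "f holomorphic_on unit_disc" "inj_on f unit_disc" "f 0 = 0"
    and lower: "\<And>z. norm z < 1 \<Longrightarrow> norm (deriv f z) \<ge> (1 - norm z) / (1 + norm z)\<^sup>2"
    and z: "norm z < 1" and seg: "\<And>s :: real. s \<in> {0..1} \<Longrightarrow> of_real s * f z \<in> f ` unit_disc"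
  shows "2 * norm z / (1 + norm z) - ln (1 + norm z) \<le> norm (f z)"
proof -
  define w where "w = f z"
  define L where "L x = 2 * x / (1 + x) - ln (1 + x)" for x :: real
  obtain k where k: "k holomorphic_on (f ` unit_disc)"
      "\<And>z. z \<in> unit_disc \<Longrightarrow> deriv f z * deriv k (f z) = 1"
      "\<And>z. z \<in> unit_disc \<Longrightarrow> k (f z) = z"
    using holomorphic_has_inverse[OF f(1) open_ball f(2)] by metis
  have op: "open (f ` unit_disc)"
    using open_mapping_thm3[OF f(1) open_ball f(2)] .
  define K where "K s = k (of_real s * w)" for s :: real
  have fK: "f (K s) = of_real s * w" "norm (K s) < 1" if s: "s \<in> {0..1}" for s
    using seg[OF s] k(3) by (auto simp: K_def w_def)
  have dK: "(K has_vector_derivative w * deriv k (of_real s * w)) (at s)" if s: "s \<in> {0..1}" for s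
  proof -
    have "(k has_field_derivative deriv k (of_real s * w)) (at (of_real s * w))"
      using seg[OF s] by (intro holomorphic_derivI[OF k(1) op]) (simp add: w_def)
    moreover have "((\<lambda>s. of_real s * w) has_vector_derivative w) (at s)"
      by (auto intro!: derivative_eq_intros)
    ultimately show ?thesis
      using field_vector_diff_chain_at[of "\<lambda>s. of_real s * w" w s k] by (simp add: o_def K_def[abs_def])
  qed
  show ?thesis
  proof (cases "w = 0")
    case True
    then have "z = 0" using inj_onD[OF f(2), of z 0] z f(3) by (simp add: w_def)
    then show ?thesis by simp
  next
    case False
    have contK: "continuous_on {0..1} K"
      using has_vector_derivative_continuous[OF dK] by (auto intro: continuous_at_imp_continuous_on)
    have "0 * norm w - L (norm (K 0)) \<le> 1 * norm w - L (norm (K 1))"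
    proof (rule DERIV_nonneg_imp_increasing_open[where f = "\<lambda>s. s * norm w - L (norm (K s))" and a = 0 and b = 1])
      show "continuous_on {0..1} (\<lambda>s. s * norm w - L (norm (K s)))"
        unfolding L_def using contK
        by (intro continuous_intros) (auto simp: add_nonneg_eq_0_iff intro: add_pos_nonneg)
      fix s :: real assume s: "0 < s" "s < 1"
      then have s': "s \<in> {0..1}" by simp
      \<comment> \<open>The norm is differentiable away from 0, and for s > 0 the path avoids 0
        because w is nonzero.\<close>
      have Kn: "K s \<noteq> 0" using fK(1)[OF s'] f(3) s False by auto
      define v where "v = w * deriv k (of_real s * w)"
      define l where "l = (1 - norm (K s)) / (1 + norm (K s))\<^sup>2"
      have "((\<lambda>s. norm (K s)) has_derivative (\<lambda>h. inner (sgn (K s)) (h *\<^sub>R v))) (at s)"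
        using has_derivative_compose[OF dK[OF s', unfolded has_vector_derivative_def] has_derivative_norm[OF Kn]]
        by (simp add: v_def inner_commute)
      then have "((\<lambda>s. norm (K s)) has_real_derivative inner (sgn (K s)) v) (at s)"
        unfolding has_field_derivative_def by (rule has_derivative_eq_rhs) (auto simp: mult.commute inner_commute v_def)
      moreover have "(L has_real_derivative l) (at (norm (K s)))"
        unfolding L_def l_def by (intro DERIV_distortion_primitive) (smt (verit) norm_ge_zero)
      ultimately have "((\<lambda>s. L (norm (K s))) has_real_derivative l * inner (sgn (K s)) v) (at s)"
        by (intro DERIV_chain2)
      then have "((\<lambda>s. s * norm w - L (norm (K s))) has_real_derivative norm w - l * inner (sgn (K s)) v) (at s)"
        by (auto intro!: derivative_eq_intros)
      moreover have "l * inner (sgn (K s)) v \<le> norm w"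
      proof -
        have K1: "norm (K s) < 1" using fK(2)[OF s'] .
        then have l: "l > 0"
          unfolding l_def by (intro divide_pos_pos zero_less_power add_pos_nonneg) auto
        have "deriv f (K s) * deriv k (of_real s * w) = 1"
          using k(2)[of "K s"] K1 fK(1)[OF s'] by simp
        then have "norm (deriv f (K s)) * norm (deriv k (of_real s * w)) = 1"
          by (metis norm_mult norm_one)
        moreover have "l * norm (deriv k (of_real s * w)) \<le> norm (deriv f (K s)) * norm (deriv k (of_real s * w))"
          using lower[OF K1] by (intro mult_right_mono) (auto simp: l_def)
        ultimately have "norm w * (l * norm (deriv k (of_real s * w))) \<le> norm w * 1"
          by (intro mult_left_mono) auto
        then have "l * norm v \<le> norm w"
          unfolding v_def norm_mult by (simp only: mult.left_commute mult.right_neutral)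
        moreover have "inner (sgn (K s)) v \<le> norm v"
          using norm_cauchy_schwarz[of "sgn (K s)" v] Kn by (simp add: norm_sgn)
        ultimately show ?thesis using l by (meson mult_left_mono less_imp_le order_trans)
      qed
      ultimately show "\<exists>y. ((\<lambda>s. s * norm w - L (norm (K s))) has_real_derivative y) (at s) \<and> 0 \<le> y"
        by (intro exI[of _ "norm w - l * inner (sgn (K s)) v"]) auto
    qed simp
    moreover have "K 0 = 0" "K 1 = z" using k(3)[of 0] k(3)[of z] f(3) z by (auto simp: K_def w_def)
    ultimately show ?thesis by (simp add: L_def w_def)
  qed
qed

text \<open>With empty frontier the image would be the plane, and the inverse a bounded entire
  function. The fact matters because \<open>infdist\<close> to the empty set is 0 by
  convention.\<close>

lemma univalent_image_frontier_nonempty: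
  assumes f: "f holomorphic_on unit_disc" "inj_on f unit_disc"
  shows "frontier (f ` unit_disc) \<noteq> {}"
proof
  assume "frontier (f ` unit_disc) = {}"
  then have U: "f ` unit_disc = UNIV" by (auto simp: frontier_eq_empty)
  obtain k where k: "k holomorphic_on UNIV" "\<And>z. z \<in> unit_disc \<Longrightarrow> k (f z) = z"
    using holomorphic_has_inverse[OF f(1) open_ball f(2)] U by metis
  have "k w \<in> unit_disc" for w
    using k(2) U by (metis (no_types) UNIV_I imageE)
  then have "bounded (range k)"
    by (intro bounded_subset[OF bounded_ball[of 0 1]]) blast
  then obtain c where "\<And>w. k w = c" using Liouville_theorem[OF k(1)] by (auto simp: constant_on_def)
  then show False using k(2)[of 0] k(2)[of "1/2"] by (simp add: norm_divide)
qed

text \<open>Let w be a nearest frontier point. The disc of radius |w| lies in the image, so for t <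
  1 the segment from 0 to t w pulls back and \<open>inverse_growth\<close> applies. As t tends to 1
  the preimage of t w leaves \<open>cball 0 \<rho>\<close>, whose image is compact and misses w;
  hence |w| \<ge> L(\<rho>), and \<rho> tends to 1.\<close>

lemma covering_radius:
  assumes f: "f holomorphic_on unit_disc" "inj_on f unit_disc" "f 0 = 0"
    and lower: "\<And>z. norm z < 1 \<Longrightarrow> norm (deriv f z) \<ge> (1 - norm z) / (1 + norm z)\<^sup>2"
  shows "1 - ln 2 \<le> infdist (f 0) (frontier (f ` unit_disc))"
proof -
  define \<Omega> where "\<Omega> = f ` unit_disc"
  have op: "open \<Omega>"
    unfolding \<Omega>_def using open_mapping_thm3[OF f(1) open_ball f(2)] .
  have z\<Omega>: "0 \<in> \<Omega>" unfolding \<Omega>_def using f(3) by (metis centre_in_ball image_eqI zero_less_one)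
  obtain w where w: "w \<in> frontier \<Omega>" "infdist 0 (frontier \<Omega>) = norm w"
    using infdist_attains_inf[OF frontier_closed, of \<Omega> 0] univalent_image_frontier_nonempty[OF f(1,2)]
    by (auto simp: \<Omega>_def)
  have w\<Omega>: "w \<notin> \<Omega>" using w(1) op by (simp add: frontier_def interior_open)
  have ball: "ball 0 (norm w) \<subseteq> \<Omega>"
  proof (rule ccontr)
    assume "\<not> ?thesis"
    moreover have "w \<noteq> 0" using w\<Omega> z\<Omega> by auto
    ultimately obtain y where "y \<in> ball 0 (norm w)" "y \<in> frontier \<Omega>"
      using connected_Int_frontier[of "ball 0 (norm w)" \<Omega>] z\<Omega> by (fastforce simp: disjoint_iff)
    then show False using infdist_le[of y "frontier \<Omega>" 0] w(2) by simp
  qed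
  have "2 * \<rho> / (1 + \<rho>) - ln (1 + \<rho>) \<le> norm w" if \<rho>: "\<rho> \<in> {0<..<1}" for \<rho>
  proof -
    have "compact (f ` cball 0 \<rho>)"
      using \<rho> by (intro compact_continuous_image holomorphic_on_imp_continuous_on
          holomorphic_on_subset[OF f(1)]) auto
    then have "open (- (f ` cball 0 \<rho>))"
      by (simp add: compact_imp_closed open_Compl)
    moreover have "w \<in> - (f ` cball 0 \<rho>)" using w\<Omega> \<rho> by (auto simp: \<Omega>_def)
    moreover have "((\<lambda>t. complex_of_real t * w) \<longlongrightarrow> complex_of_real 1 * w) (at_left 1)"
      by (intro tendsto_intros)
    ultimately have "\<forall>\<^sub>F t in at_left 1. complex_of_real t * w \<in> - (f ` cball 0 \<rho>)"
      by (intro topological_tendstoD) auto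
    then have "\<forall>\<^sub>F t in at_left 1. complex_of_real t * w \<in> - (f ` cball 0 \<rho>) \<and> t \<in> {0<..<1}"
      using eventually_at_left_real[of 0 "1::real", OF zero_less_one] by (rule eventually_conj)
    then obtain t :: real where t: "t * w \<notin> f ` cball 0 \<rho>" "0 < t" "t < 1"
      using eventually_happens by fastforce
    have wn: "norm w > 0" using w\<Omega> z\<Omega> by auto
    have in\<Omega>: "of_real s * (of_real t * w) \<in> \<Omega>" if "s \<in> {0..1}" for s :: real
    proof (rule subsetD[OF ball])
      have "s * t * norm w < 1 * norm w"
      proof (rule mult_strict_right_mono)
        have "s * t \<le> 1 * t" using that t by (intro mult_right_mono) auto
        then show "s * t < 1" using t by linarith
      qed (rule wn)
      then show "of_real s * (of_real t * w) \<in> ball 0 (norm w)"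
        using that t by (simp add: norm_mult mult.assoc)
    qed
    from in\<Omega>[of 1] obtain z where z: "norm z < 1" "f z = t * w" by (auto simp: \<Omega>_def)
    have "norm z > \<rho>" using t(1) z(2) by (force simp: not_le[symmetric])
    define L where "L x = 2 * x / (1 + x) - ln (1 + x)" for x :: real
    have "L \<rho> \<le> L (norm z)"
      unfolding L_def
      by (rule DERIV_nonneg_imp_nondecreasing)
         (use \<open>norm z > \<rho>\<close> \<rho> z(1) in \<open>auto intro!: exI conjI DERIV_distortion_primitive\<close>)
    also have "\<dots> \<le> norm (f z)"
      unfolding L_def by (rule inverse_growth[OF f lower z(1)]) (use in\<Omega> z(2) in \<open>auto simp: \<Omega>_def\<close>)
    also have "\<dots> \<le> norm w" using z(2) t by (simp add: norm_mult mult_left_le_one_le)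
    finally show ?thesis by (simp add: L_def)
  qed
  moreover have "((\<lambda>\<rho>::real. 2 * \<rho> / (1 + \<rho>) - ln (1 + \<rho>)) \<longlongrightarrow> 2 * 1 / (1 + 1) - ln (1 + 1)) (at_left 1)"
    by (intro tendsto_intros) auto
  moreover have "\<forall>\<^sub>F \<rho> in at_left 1. \<rho> \<in> {0<..<1::real}"
    using eventually_at_left_real[of 0 "1::real", OF zero_less_one] .
  ultimately have "2 * 1 / (1 + 1) - ln (1 + 1) \<le> norm w"
    by (intro tendsto_upperbound[where F = "at_left (1::real)" 
          and f = "\<lambda>\<rho>. 2 * \<rho> / (1 + \<rho>) - ln (1 + \<rho>)"]) (auto elim!: eventually_mono)
  then show ?thesis using w(2) f(3) by (simp add: \<Omega>_def)
qed

section \<open>Distortion and coefficients\<close>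

lemma class_C1_product:
  assumes "f \<in> class_C1"
  obtains p M k where "f holomorphic_on unit_disc" "f 0 = 0" "deriv f 0 = 1" "inj_on f unit_disc"
    "p holomorphic_on unit_disc" "\<And>z. norm z < 1 \<Longrightarrow> Re (p z) > 0"
    "M holomorphic_on unit_disc" "\<And>z. norm z < 1 \<Longrightarrow> M z \<noteq> 0"
    "k holomorphic_on unit_disc" "k 0 = 0"
    "\<And>z. norm z < 1 \<Longrightarrow> z * deriv M z = k z * M z" "\<And>z. norm z < 1 \<Longrightarrow> Re (k z) \<ge> - 1 / 2"
    "\<And>z. norm z < 1 \<Longrightarrow> deriv f z = p z * M z"
proof -
  from assms obtain g p where f: "f holomorphic_on unit_disc" "f 0 = 0" "deriv f 0 = 1"
    and g: "convex_function g" "g 0 = 0"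
    and p: "p holomorphic_on unit_disc" "\<And>z. z \<in> unit_disc - {0} \<Longrightarrow> p z = z * deriv f z / g z"
      "\<And>z. z \<in> unit_disc \<Longrightarrow> Re (p z) > 0"
    unfolding class_C1_def by blast
  obtain M k where M: "M holomorphic_on unit_disc" and k: "k holomorphic_on unit_disc" "k 0 = 0"
    and M0: "M 0 = deriv g 0"
    and gM: "\<And>z. norm z < 1 \<Longrightarrow> g z = z * M z" and nz: "\<And>z. norm z < 1 \<Longrightarrow> M z \<noteq> 0"
    and dM: "\<And>z. norm z < 1 \<Longrightarrow> z * deriv M z = k z * M z"
    and dg: "\<And>z. norm z < 1 \<Longrightarrow> z * deriv g z = (1 + k z) * g z"
    and re: "\<And>z. norm z < 1 \<Longrightarrow> Re (k z) \<ge> - 1 / 2"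
    using convex_function_quotient[OF g] by blast
  have eq': "deriv f z = p z * M z" if "norm z < 1" "z \<noteq> 0" for z
    using p(2)[of z] that gM[OF that(1)] nz[OF that(1)] by (simp add: field_simps)
  have "deriv f 0 = p 0 * M 0"
  proof -
    \<comment> \<open>The hypothesis identifies \<open>p\<close> with the quotient only away from 0,
      so the factorisation is carried to 0 by continuity.\<close>
    define h where "h z = deriv f z - p z * M z" for z
    have "h holomorphic_on unit_disc"
      unfolding h_def by (intro holomorphic_intros holomorphic_deriv f p M open_ball)
    then have "isCont h 0"
      using holomorphic_on_imp_continuous_on continuous_on_eq_continuous_at[OF open_ball, of 0 1 h] by auto
    then have "h \<midarrow>0\<rightarrow> h 0" by (simp add: isCont_def)
    moreover have "\<forall>\<^sub>F z in at 0. h z = 0"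
      using eventually_at_in_open[of unit_disc "0::complex"] by (auto elim!: eventually_mono simp: h_def eq')
    then have "h \<midarrow>0\<rightarrow> 0" by (rule tendsto_eventually)
    ultimately have "h 0 = 0" by (rule LIM_unique)
    then show ?thesis by (simp add: h_def)
  qed
  then have eq: "deriv f z = p z * M z" if "norm z < 1" for z
    using eq' that by (cases "z = 0") auto
  have "inj_on f unit_disc"
  \<comment> \<open>The starlikeness factor z g'/g is 1 + k, with real part at least 1/2.\<close>
  proof (rule close_to_starlike_injective[where g = g and p = p and k = "\<lambda>z. 1 + k z"])
    show "g holomorphic_on unit_disc" "inj_on g unit_disc"
      using g by (auto simp: convex_function_def)
    show "z * deriv f z = p z * g z" if "norm z < 1" for z
      using eq[OF that] gM[OF that] by simp
    show "Re (1 + k z) > 0" if "norm z < 1" for z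
      using re[OF that] by simp
    show "deriv g 0 \<noteq> 0" using nz[of 0] M0 by simp
    show "deriv f 0 = p 0 * deriv g 0" using eq[of 0] M0 by simp
  qed (use f g p dg k in auto)
  with that f p M nz k dM re eq show ?thesis by (metis mem_ball_0)
qed

text \<open>With r = |z| and relative to the values at 0, |p| lies between (1 - r)/(1 + r) and (1 +
  r)/(1 - r), and |M| between 1/(1 + r) and 1/(1 - r); multiply. The coefficient bound comes from
  the Cauchy product for f' = p M.\<close>

lemma class_C1_distortion:
  assumes "f \<in> class_C1" "norm z < 1"
  shows "norm (deriv f z) \<ge> (1 - norm z) / (1 + norm z)\<^sup>2"
    and "norm (deriv f z) \<le> (1 + norm z) / (1 - norm z)\<^sup>2"
    and "norm (taylor_coeff f (Suc n)) \<le> 2 - 1 / real (Suc n)"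
proof -
  obtain p M k where f: "f holomorphic_on unit_disc" "deriv f 0 = 1"
    and p: "p holomorphic_on unit_disc" "\<And>z. norm z < 1 \<Longrightarrow> Re (p z) > 0"
    and M: "M holomorphic_on unit_disc" "\<And>z. norm z < 1 \<Longrightarrow> M z \<noteq> 0"
    and k: "k holomorphic_on unit_disc" "k 0 = 0"
      "\<And>z. norm z < 1 \<Longrightarrow> z * deriv M z = k z * M z" "\<And>z. norm z < 1 \<Longrightarrow> Re (k z) \<ge> - 1 / 2"
    and eq: "\<And>z. norm z < 1 \<Longrightarrow> deriv f z = p z * M z"
    using class_C1_product[OF assms(1)] by metis
  \<comment> \<open>\<open>deriv g 0\<close> is not normalised; only the product p(0) M(0) = f'(0) =
    1 is, so the bounds for \<open>p\<close> and \<open>M\<close> stay relative to their values at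
    0.\<close>
  have one: "norm (p 0) * norm (M 0) = 1"
    using eq[of 0] f(2) by (metis norm_mult norm_one norm_zero zero_less_one)
  have p_nz: "p z \<noteq> 0" if "norm z < 1" for z using p(2)[OF that] by auto
  \<comment> \<open>The lower bound for |p| is the upper bound for 1/p, whose real part is also
    positive.\<close>
  have "norm (inverse (p z)) \<le> norm (inverse (p 0)) * (1 + norm z) / (1 - norm z)"
  proof (rule caratheodory_growth[OF _ _ assms(2)])
    show "(\<lambda>z. inverse (p z)) holomorphic_on unit_disc"
      using p_nz by (intro holomorphic_intros p) auto
    show "Re (inverse (p z)) \<ge> 0" if "norm z < 1" for z
      using p(2)[OF that] by simp
  qed
  then have "norm (p 0) * (1 - norm z) \<le> norm (p z) * (1 + norm z)"
    unfolding norm_inverse using p_nz[OF assms(2)] p_nz[of 0] assms(2) by (simp add: field_simps)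
  moreover have "norm (M 0) \<le> norm (M z) * (1 + norm z)"
    by (rule starlike_quotient_growth[OF M k assms(2)])
  ultimately have "(norm (p 0) * (1 - norm z)) * norm (M 0) \<le> (norm (p z) * (1 + norm z)) * (norm (M z) * (1 + norm z))"
    by (rule mult_mono) auto
  also have "(norm (p 0) * (1 - norm z)) * norm (M 0) = (norm (p 0) * norm (M 0)) * (1 - norm z)"
    by (simp only: mult_ac)
  also have "(norm (p z) * (1 + norm z)) * (norm (M z) * (1 + norm z)) = norm (deriv f z) * (1 + norm z)\<^sup>2"
    by (simp add: eq[OF assms(2)] norm_mult power2_eq_square mult_ac)
  finally have "1 - norm z \<le> norm (deriv f z) * (1 + norm z)\<^sup>2"
    by (simp add: one)
  moreover have "(1 + norm z)\<^sup>2 > 0" by (intro zero_less_power add_pos_nonneg) auto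
  ultimately show "norm (deriv f z) \<ge> (1 - norm z) / (1 + norm z)\<^sup>2"
    by (simp add: divide_le_eq)
  define F P N where "F = fps_expansion f 0" and "P = fps_expansion p 0" and "N = fps_expansion M 0"
  have F: "f has_fps_expansion F" and P: "p has_fps_expansion P" and N: "M has_fps_expansion N"
    unfolding F_def P_def N_def using f p M by (auto intro: fps_expansion_disc)
  have "deriv f has_fps_expansion fps_deriv F"
    using F by (intro fps_expansion_intros)
  moreover have "(\<lambda>z. p z * M z) has_fps_expansion P * N"
    using P N by (intro fps_expansion_intros)
  moreover have "\<forall>\<^sub>F z in nhds 0. p z * M z = deriv f z"
    using eventually_nhds_in_open[of unit_disc 0] by (auto elim!: eventually_mono simp: eq)
  ultimately have ser: "fps_deriv F = P * N"
    by (metis fps_expansion_unique_complex has_fps_expansion_cong)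
  have Nn: "norm (fps_nth N i) \<le> norm (M 0)" for i
    unfolding N_def by (rule starlike_quotient_coeff_bound[OF M(1) k])
  have "norm (p z) \<le> norm (p 0) * (1 + norm z) / (1 - norm z)"
    by (rule caratheodory_growth[OF p(1) less_imp_le[OF p(2)] assms(2)])
  moreover have "norm (M z) \<le> norm (M 0) * (1 / (1 - norm z))"
  proof -
    have s1: "(\<lambda>i. fps_nth N i * z ^ i) sums M z"
      unfolding N_def by (rule fps_expansion_disc(2)[OF M(1) assms(2)])
    have s2: "(\<lambda>i. norm (M 0) * norm z ^ i) sums (norm (M 0) * (1 / (1 - norm z)))"
      using assms(2) by (intro sums_mult geometric_sums) simp
    have "norm (fps_nth N i * z ^ i) \<le> norm (M 0) * norm z ^ i" for i
      using Nn[of i] by (simp add: norm_mult norm_power mult_right_mono)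
    then have "norm (\<Sum>i. fps_nth N i * z ^ i) \<le> (\<Sum>i. norm (M 0) * norm z ^ i)"
      by (rule norm_suminf_le[OF _ sums_summable[OF s2]])
    then show ?thesis
      using sums_unique[OF s1] sums_unique[OF s2] by simp
  qed
  ultimately have "norm (p z) * norm (M z) \<le> (norm (p 0) * (1 + norm z) / (1 - norm z)) * (norm (M 0) * (1 / (1 - norm z)))"
    using assms(2) by (intro mult_mono) auto
  also have "\<dots> = (norm (p 0) * norm (M 0)) * (1 + norm z) / (1 - norm z)\<^sup>2"
    by (simp add: power2_eq_square)
  finally show "norm (deriv f z) \<le> (1 + norm z) / (1 - norm z)\<^sup>2"
    by (simp add: eq[OF assms(2)] norm_mult one)
  have P0: "norm (fps_nth P 0) = norm (p 0)" by (simp add: P_def fps_expansion_def)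
  have Pn: "norm (fps_nth P i) \<le> 2 * norm (p 0)" if "i > 0" for i
    using caratheodory_coeff_bound[OF p(1) less_imp_le[OF p(2)] that] complex_Re_le_cmod[of "p 0"]
    by (simp add: P_def)
  have "of_nat (Suc n) * fps_nth F (Suc n) = (\<Sum>i=0..n. fps_nth P i * fps_nth N (n - i))"
    using arg_cong[OF ser, of "\<lambda>G. fps_nth G n"] by (simp add: fps_mult_nth)
  then have "real (Suc n) * norm (fps_nth F (Suc n)) = norm (\<Sum>i=0..n. fps_nth P i * fps_nth N (n - i))"
    by (metis norm_mult norm_of_nat)
  also have "\<dots> \<le> (\<Sum>i=0..n. norm (fps_nth P i) * norm (fps_nth N (n - i)))"
    by (rule order.trans[OF norm_sum]) (simp add: norm_mult)
  also have "\<dots> = norm (fps_nth P 0) * norm (fps_nth N n) + (\<Sum>i=1..n. norm (fps_nth P i) * norm (fps_nth N (n - i)))"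
    by (simp add: sum.atLeast_Suc_atMost)
  \<comment> \<open>One term carries |p(0)| and the other n carry 2 |p(0)|, giving 1 + 2n; dividing
    by n + 1 yields 2 - 1/(n + 1).\<close>
  also have "\<dots> \<le> norm (p 0) * norm (M 0) + (\<Sum>i=1..n. (2 * norm (p 0)) * norm (M 0))"
    using Nn Pn P0 by (intro add_mono sum_mono mult_mono) auto
  also have "\<dots> = 1 + 2 * real n"
    using one by (simp add: mult.assoc)
  finally show "norm (taylor_coeff f (Suc n)) \<le> 2 - 1 / real (Suc n)"
    by (simp add: taylor_coeff_def F_def field_simps)
qed

section \<open>The Bohr majorant and its root\<close>

text \<open>For 0 \<le> r < 1 this is the sum of (2 - 1/n) r^n over n \<ge> 1. Its value at -1 is ln
  2 - 1, the negative of the covering radius.\<close>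

definition extremal_real :: "real \<Rightarrow> real" where
  "extremal_real r = 2 * r / (1 - r) + ln (1 - r)"

text \<open>For r = |z|, \<open>extremal_real r\<close> bounds |f(z)|,
  \<open>extremal_real r - r\<close> bounds the series from n = 2 on (the removed first coefficient
  is 1), and the last summand bounds the derivative term.\<close>

definition bohr_majorant :: "real \<Rightarrow> real" where
  "bohr_majorant r = 2 * extremal_real r - r + r * (1 + r) / (1 - r)\<^sup>2"

lemma DERIV_extremal_real:
  assumes "r < 1"
  shows "(extremal_real has_real_derivative (1 + r) / (1 - r)\<^sup>2) (at r)"
proof -
  have "(extremal_real has_real_derivative
      (2 * (1 - r) + 2 * r) / ((1 - r) * (1 - r)) - 1 / (1 - r)) (at r)"
    unfolding extremal_real_def using assms by (auto intro!: derivative_eq_intros)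
  also have "(2 * (1 - r) + 2 * r) / ((1 - r) * (1 - r)) - 1 / (1 - r) = (1 + r) / (1 - r)\<^sup>2"
    using assms by (simp add: divide_simps) (simp add: power2_eq_square algebra_simps)
  finally show ?thesis .
qed

lemma extremal_real_strict_mono:
  assumes "-1 \<le> a" "a < b" "b < 1"
  shows "extremal_real a < extremal_real b"
proof (rule DERIV_pos_imp_increasing_open[OF assms(2)])
  show "continuous_on {a..b} extremal_real"
    using assms by (auto intro!: continuous_at_imp_continuous_on DERIV_isCont[OF DERIV_extremal_real])
  show "\<exists>y. (extremal_real has_real_derivative y) (at x) \<and> 0 < y" if "a < x" "x < b" for x
    using that assms by (intro exI[of _ "(1 + x) / (1 - x)\<^sup>2"]) (auto intro!: DERIV_extremal_real)
qed

lemma bohr_majorant_strict_mono: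
  assumes "0 \<le> a" "a < b" "b < 1"
  shows "bohr_majorant a < bohr_majorant b"
proof -
  have "2 * extremal_real a - a < 2 * extremal_real b - b"
  proof (rule DERIV_pos_imp_increasing_open[OF assms(2)])
    have d: "((\<lambda>x. 2 * extremal_real x - x) has_real_derivative 2 * ((1 + x) / (1 - x)\<^sup>2) - 1) (at x)" 
      if "x < 1" for x
      using DERIV_extremal_real[OF that] by (auto intro!: derivative_eq_intros)
    show "continuous_on {a..b} (\<lambda>x. 2 * extremal_real x - x)"
      using assms d by (intro continuous_at_imp_continuous_on ballI) (meson DERIV_isCont atLeastAtMost_iff order_le_less_trans)
    fix x assume x: "a < x" "x < b"
    then have "(1 - x)\<^sup>2 \<le> 1" using assms by (intro power_le_one) auto
    then have "(1 - x)\<^sup>2 \<le> 1 + x" using x assms by linarith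
    then have "1 \<le> (1 + x) / (1 - x)\<^sup>2" using x assms by simp
    then have "0 < 2 * ((1 + x) / (1 - x)\<^sup>2) - 1" by linarith
    then show "\<exists>y. ((\<lambda>x. 2 * extremal_real x - x) has_real_derivative y) (at x) \<and> 0 < y"
      using d[of x] x assms by auto
  qed
  moreover have "a * (1 + a) / (1 - a)\<^sup>2 \<le> b * (1 + b) / (1 - b)\<^sup>2"
    using assms by (intro frac_le mult_mono power_mono) auto
  ultimately show ?thesis by (simp add: bohr_majorant_def)
qed

text \<open>The defining equation is \<open>bohr_majorant r = 1 - ln 2\<close> multiplied by the
  nonzero factor (1 - r)^2, with ln 4 = 2 ln 2.\<close>

lemma r11_equation_iff:
  assumes "r < 1"
  shows "r11_equation r \<longleftrightarrow> bohr_majorant r = 1 - ln 2"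
proof -
  have "ln 4 = 2 * ln (2::real)" using ln_realpow[of 2 2] by simp
  moreover have "(1 - r)\<^sup>2 * (2 * r / (1 - r)) = 2 * r * (1 - r)" 
    and "(1 - r)\<^sup>2 * (r * (1 + r) / (1 - r)\<^sup>2) = r * (1 + r)"
    using assms by (simp_all add: power2_eq_square)
  ultimately have "ln 2 - 1 - r * (- 6 + r * (2 + r - ln 2) + ln 4) + 2 * (1 - r)\<^sup>2 * ln (1 - r) 
     = (1 - r)\<^sup>2 * (bohr_majorant r - (1 - ln 2))"
    unfolding bohr_majorant_def extremal_real_def by algebra
  then show ?thesis using assms by (simp add: r11_equation_def)
qed

lemma r11_exists:
  obtains r where "0 < r" "r < 1" "r11_equation r" "\<bar>r - 0.110377\<bar> < 0.0000005"
proof -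
  \<comment> \<open>Merging ln 2 and 2 ln(1 - r) leaves a single logarithm, so each sign of
    \<open>h\<close> needs only one logarithm estimate.\<close>
  define h where "h r = (1 - r)\<^sup>2 * ln (2 * (1 - r)\<^sup>2) - 1 + 6 * r - 2 * r\<^sup>2 - r ^ 3" for r :: real
  have h_eq: "r11_equation r \<longleftrightarrow> h r = 0" if "r < 1" for r
  proof -
    have "ln 4 = 2 * ln (2::real)" using ln_realpow[of 2 2] by simp
    moreover have "ln (2 * (1 - r)\<^sup>2) = ln 2 + 2 * ln (1 - r)"
      using that by (simp add: ln_mult ln_realpow)
    ultimately have "ln 2 - 1 - r * (- 6 + r * (2 + r - ln 2) + ln 4) + 2 * (1 - r)\<^sup>2 * ln (1 - r) = h r"
      by (simp add: h_def power2_eq_square power3_eq_cube algebra_simps)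
    then show ?thesis by (simp add: r11_equation_def)
  qed
  \<comment> \<open>\<open>2235/1412\<close> and \<open>1920/1213\<close> approximate \<open>2 (1 - r)\<^sup>2\<close> at the two end points.\<close>
  define lo hi :: real where "lo = 0.1103765" and "hi = 0.1103775"
  have "ln (2 * (1 - lo)\<^sup>2) \<le> ln (2235 / 1412)"
    by (subst ln_le_cancel_iff) (simp_all add: lo_def power2_eq_square)
  also have "\<dots> \<le> 0.4592341"
    using ln_approx_bounds[of "2235 / 1412" 4] by (simp add: eval_nat_numeral)
  finally have "ln (2 * (1 - lo)\<^sup>2) \<le> 0.4592341" .
  then have "(1 - lo)\<^sup>2 * ln (2 * (1 - lo)\<^sup>2) \<le> (1 - lo)\<^sup>2 * 0.4592341"
    by (intro mult_left_mono) auto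
  then have lo: "h lo < 0"
    by (simp add: h_def lo_def power2_eq_square power3_eq_cube)
  have "0.4592282 \<le> ln (1920 / 1213 :: real)"
    using ln_approx_bounds[of "1920 / 1213" 4] by (simp add: eval_nat_numeral)
  also have "\<dots> \<le> ln (2 * (1 - hi)\<^sup>2)"
    by (subst ln_le_cancel_iff) (simp_all add: hi_def power2_eq_square)
  finally have "ln (2 * (1 - hi)\<^sup>2) \<ge> 0.4592282" .
  then have "(1 - hi)\<^sup>2 * ln (2 * (1 - hi)\<^sup>2) \<ge> (1 - hi)\<^sup>2 * 0.4592282"
    by (intro mult_left_mono) auto
  then have hi: "h hi > 0"
    by (simp add: h_def hi_def power2_eq_square power3_eq_cube)
  have "continuous_on {lo..hi} h"
    unfolding h_def by (intro continuous_intros) (auto simp: hi_def)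
  then obtain r where r: "lo \<le> r" "r \<le> hi" "h r = 0"
    using IVT'[of h lo 0 hi] lo hi by (force simp: lo_def hi_def)
  have "r \<noteq> lo" "r \<noteq> hi" using r(3) lo hi by auto
  then have "lo < r" "r < hi" using r by auto
  then have "0 < r" "r < 1" "\<bar>r - 0.110377\<bar> < 0.0000005"
    by (auto simp: abs_if lo_def hi_def)
  then show ?thesis using r(3) h_eq[of r] that by blast
qed

section \<open>The extremal function\<close>

definition extremal :: "complex \<Rightarrow> complex" where
  "extremal z = 2 * z / (1 - z) + Ln (1 - z)"

text \<open>The constant coefficient is set apart because 1/0 = 0 would make the formula give 2
  there.\<close>

definition extremal_coeff :: "nat \<Rightarrow> real" where
  "extremal_coeff n = (if n = 0 then 0 else 2 - 1 / real n)"

lemma extremal_coeff_nonneg: "extremal_coeff n \<ge> 0"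
proof (cases n)
  case (Suc m)
  then have "1 / real n \<le> 1" by simp
  then show ?thesis by (simp add: extremal_coeff_def)
qed (simp add: extremal_coeff_def)

lemma extremal_sums:
  assumes z: "norm z < 1"
  shows "(\<lambda>n. of_real (extremal_coeff n) * z ^ n) sums extremal z"
proof -
  have ser: "(\<lambda>n. (- 1) ^ Suc n / of_nat n * (- z) ^ n) sums Ln (1 + - z)"
    using z by (intro Ln_series) simp
  have eq: "(- 1) ^ Suc n / of_nat n * (- z) ^ n = - (z ^ n) / of_nat n" for n
  proof -
    have "(- 1) ^ n * (- z) ^ n = ((- 1) * (- z)) ^ n" by (rule power_mult_distrib[symmetric])
    then show ?thesis by simp
  qed
  have "(\<lambda>n. - (z ^ n) / of_nat n) sums Ln (1 - z)"
    using ser unfolding eq by simp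
  \<comment> \<open>The constant term is removed, leaving 2z/(1 - z); in the logarithmic series the
    term n = 0 is already 0 by the convention on division.\<close>
  moreover have "(\<lambda>n. 2 * z ^ n - (if n = 0 then 2 else 0)) sums (2 * (1 / (1 - z)) - 2)"
    using z sums_single[of 0 "\<lambda>_. 2 :: complex"] by (intro sums_diff sums_mult geometric_sums) auto
  ultimately have "(\<lambda>n. (2 * z ^ n - (if n = 0 then 2 else 0)) + - (z ^ n) / of_nat n) sums 
      ((2 * (1 / (1 - z)) - 2) + Ln (1 - z))"
    by (intro sums_add)
  moreover have "(2 * z ^ n - (if n = 0 then 2 else 0)) + - (z ^ n) / of_nat n = of_real (extremal_coeff n) * z ^ n" for n
    by (simp add: extremal_coeff_def field_simps)
  moreover have "(2 * (1 / (1 - z)) - 2) + Ln (1 - z) = extremal z"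
  proof -
    have "1 - z \<noteq> 0" using z by auto
    then show ?thesis by (simp add: extremal_def field_simps)
  qed
  ultimately show ?thesis by simp
qed

lemma extremal_of_real:
  assumes "r < 1"
  shows "extremal (of_real r) = of_real (extremal_real r)"
proof -
  have "Ln (1 - of_real r) = of_real (ln (1 - r))"
    using Ln_of_real[of "1 - r"] assms by simp
  then show ?thesis by (simp add: extremal_def extremal_real_def)
qed

lemma extremal_real_sums:
  assumes "0 \<le> r" "r < 1"
  shows "(\<lambda>n. extremal_coeff n * r ^ n) sums extremal_real r"
proof -
  have "(\<lambda>n. of_real (extremal_coeff n * r ^ n)) sums complex_of_real (extremal_real r)"
    using extremal_sums[of "of_real r"] extremal_of_real[of r] assms by simp
  then show ?thesis unfolding sums_of_real_iff .
qed

lemma extremal_real_tail_sums: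
  assumes "0 \<le> r" "r < 1"
  shows "(\<lambda>n. extremal_coeff (n + 2) * r ^ (n + 2)) sums (extremal_real r - r)"
  using sums_split_initial_segment[OF extremal_real_sums[OF assms], of 2]
  by (simp add: numeral_2_eq_2 extremal_coeff_def)

lemma bohr_sum_le:
  assumes f: "f \<in> class_C1" and z: "norm z < 1"
  shows "bohr_sum f z \<le> bohr_majorant (norm z)"
proof -
  define r where "r = norm z"
  have r: "0 \<le> r" "r < 1" using z by (auto simp: r_def)
  have hol: "f holomorphic_on unit_disc" and f0: "f 0 = 0"
    using f by (auto simp: class_C1_def)
  define a where "a n = taylor_coeff f n" for n
  have a: "norm (a n) \<le> extremal_coeff n" for n
    using class_C1_distortion(3)[OF f z] f0
    by (cases n) (auto simp: a_def taylor_coeff_def fps_expansion_def extremal_coeff_def)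
  have az: "norm (a n * z ^ n) \<le> extremal_coeff n * r ^ n" for n
    using a[of n] r by (simp add: norm_mult norm_power r_def mult_right_mono)
  have sums: "(\<lambda>n. a n * z ^ n) sums f z"
    using fps_expansion_disc(2)[OF hol z] by (simp add: a_def taylor_coeff_def)
  have E: "(\<lambda>n. extremal_coeff n * r ^ n) sums extremal_real r"
    by (rule extremal_real_sums[OF r])
  have T: "(\<lambda>n. extremal_coeff (n + 2) * r ^ (n + 2)) sums (extremal_real r - r)"
    by (rule extremal_real_tail_sums[OF r])
  have "norm (f z) \<le> extremal_real r"
    using norm_suminf_le[OF az sums_summable[OF E]] sums E by (simp add: sums_iff)
  moreover have "(\<Sum>n. norm (a (n + 2) * z ^ (n + 2))) \<le> extremal_real r - r"
  proof -
    have "summable (\<lambda>n. norm (a (n + 2) * z ^ (n + 2)))"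
      by (rule summable_comparison_test'[OF sums_summable[OF T], of 0])
        (unfold real_norm_def abs_norm_cancel, rule az)
    then have "(\<Sum>n. norm (a (n + 2) * z ^ (n + 2))) \<le> (\<Sum>n. extremal_coeff (n + 2) * r ^ (n + 2))"
      by (rule suminf_le[OF az _ sums_summable[OF T]])
    then show ?thesis using T by (simp add: sums_iff)
  qed
  moreover have "norm (deriv f z) \<le> (1 + r) / (1 - r)\<^sup>2"
    unfolding r_def by (rule class_C1_distortion(2)[OF f z])
  then have "norm (deriv f z) * r \<le> (1 + r) / (1 - r)\<^sup>2 * r"
    using r by (intro mult_right_mono) auto
  ultimately show ?thesis
    by (simp add: bohr_sum_def bohr_majorant_def a_def r_def[symmetric] mult.commute)
qed

lemma extremal_holomorphic: "extremal holomorphic_on unit_disc"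
proof -
  have "1 - z \<notin> \<real>\<^sub>\<le>\<^sub>0" if "norm z < 1" for z :: complex
    using that complex_Re_le_cmod[of z] by (auto simp: complex_nonpos_Reals_iff)
  moreover have "1 - z \<noteq> 0" if "norm z < 1" for z :: complex using that by auto
  ultimately show ?thesis unfolding extremal_def by (intro holomorphic_intros) auto
qed

lemma deriv_extremal:
  assumes z: "norm z < 1"
  shows "deriv extremal z = (1 + z) / (1 - z)\<^sup>2"
proof (rule DERIV_imp_deriv)
  have nz: "1 - z \<noteq> 0" using z by auto
  have "1 - z \<notin> \<real>\<^sub>\<le>\<^sub>0"
    using z complex_Re_le_cmod[of z] by (auto simp: complex_nonpos_Reals_iff)
  then have "((\<lambda>z. Ln (1 - z)) has_field_derivative - (1 / (1 - z))) (at z)"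
    by (auto intro!: derivative_eq_intros simp: divide_inverse)
  moreover have "((\<lambda>z. 2 * z / (1 - z)) has_field_derivative (2 * (1 - z) + 2 * z) / ((1 - z) * (1 - z))) (at z)"
    using nz by (auto intro!: derivative_eq_intros)
  ultimately have "(extremal has_field_derivative (2 * (1 - z) + 2 * z) / ((1 - z) * (1 - z)) - 1 / (1 - z)) (at z)"
    unfolding extremal_def[abs_def] using DERIV_add by fastforce
  also have "(2 * (1 - z) + 2 * z) / ((1 - z) * (1 - z)) - 1 / (1 - z) = (1 + z) / (1 - z)\<^sup>2"
    using nz by (simp add: divide_simps) (simp add: power2_eq_square algebra_simps)
  finally show "(extremal has_field_derivative (1 + z) / (1 - z)\<^sup>2) (at z)" .
qed

text \<open>The inverse map is w/(1 + w), and |w| < |1 + w| says that w is closer to 0 than to -1.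
  So the image is a half-plane.\<close>

lemma convex_function_half_plane: "convex_function (\<lambda>z. z / (1 - z))"
proof -
  have nz: "1 - z \<noteq> 0" if "norm z < 1" for z :: complex using that by auto
  have "(\<lambda>z. z / (1 - z)) holomorphic_on unit_disc"
    using nz by (intro holomorphic_intros) auto
  moreover have "inj_on (\<lambda>z::complex. z / (1 - z)) unit_disc"
    using nz by (intro inj_onI) (simp add: field_simps)
  moreover have "(\<lambda>z. z / (1 - z)) ` unit_disc = {w. Re w > - 1 / 2}"
  proof -
    have half: "norm w < norm (1 + w) \<longleftrightarrow> Re w > - 1 / 2" for w
    proof -
      have "(norm (1 + w))\<^sup>2 \<le> (norm w)\<^sup>2 \<longleftrightarrow> norm (1 + w) \<le> norm w"
        by (rule power_mono_iff) auto
      moreover have "(norm (1 + w))\<^sup>2 - (norm w)\<^sup>2 = 1 + 2 * Re w"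
        unfolding cmod_power2 by (simp add: power2_eq_square algebra_simps)
      ultimately show ?thesis by linarith
    qed
    show ?thesis
    proof (intro equalityI subsetI)
      fix w assume "w \<in> (\<lambda>z. z / (1 - z)) ` unit_disc"
      then obtain z where z: "norm z < 1" "w = z / (1 - z)" by auto
      then have "1 + w = 1 / (1 - z)" using nz[OF z(1)] by (simp add: field_simps)
      then have "norm w < norm (1 + w)"
        using z nz[OF z(1)] by (simp add: norm_divide divide_strict_right_mono)
      then show "w \<in> {w. Re w > - 1 / 2}" using half by simp
    next
      fix w assume "w \<in> {w. Re w > - 1 / 2}"
      then have w: "norm w < norm (1 + w)" using half by simp
      then have w0: "1 + w \<noteq> 0" by auto
      then have "w = (w / (1 + w)) / (1 - w / (1 + w))" by (simp add: field_simps)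
      moreover have "w / (1 + w) \<in> unit_disc" using w w0 by (simp add: norm_divide)
      ultimately show "w \<in> (\<lambda>z. z / (1 - z)) ` unit_disc" by blast
    qed
  qed
  ultimately show ?thesis
    by (simp add: convex_function_def convex_halfspace_Re_gt)
qed

lemma extremal_in_class_C1: "extremal \<in> class_C1"
proof -
  have "((\<lambda>z::complex. z / (1 - z)) has_field_derivative 1) (at 0)"
    by (auto intro!: derivative_eq_intros)
  then have g': "deriv (\<lambda>z::complex. z / (1 - z)) 0 = 1" by (rule DERIV_imp_deriv)
  have nz: "1 - z \<noteq> 0" if "norm z < 1" for z :: complex using that by auto
  have p: "(\<lambda>z. (1 + z) / (1 - z)) holomorphic_on unit_disc"
    using nz by (intro holomorphic_intros) auto
  have quot: "(1 + z) / (1 - z) = z * deriv extremal z / (z / (1 - z))" if "z \<in> unit_disc - {0}" for z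
    using that nz[of z] by (simp add: deriv_extremal power2_eq_square)
  have pos: "Re ((1 + z) / (1 - z)) > 0" if "z \<in> unit_disc" for z
  proof -
    have "(norm z)\<^sup>2 < 1" using that by (simp add: abs_square_less_1)
    then have "(1 + Re z) * (1 - Re z) - Im z * Im z > 0"
      unfolding cmod_power2 by (simp add: power2_eq_square algebra_simps)
    moreover have "(1 - Re z)\<^sup>2 + (Im z)\<^sup>2 > 0"
      using nz[of z] that by (auto simp: complex_eq_iff sum_power2_gt_zero_iff)
    ultimately show ?thesis by (simp add: Re_divide)
  qed
  show ?thesis unfolding class_C1_def mem_Collect_eq
    by (intro conjI exI[of _ "\<lambda>z. z / (1 - z)"] exI[of _ "\<lambda>z. (1 + z) / (1 - z)"] ballI
        extremal_holomorphic convex_function_half_plane p quot pos)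
      (auto simp: g' deriv_extremal extremal_def)
qed

text \<open>The segment from \<open>a\<close> to \<open>w\<close> meets both \<open>S\<close> and
  its complement, hence the frontier, at a point no farther from \<open>a\<close> than
  \<open>w\<close> is.\<close>

lemma infdist_frontier_le:
  fixes a w :: "'a :: euclidean_space"
  assumes "a \<in> S" "w \<notin> S"
  shows "infdist a (frontier S) \<le> dist a w"
proof -
  obtain y where y: "y \<in> closed_segment a w" "y \<in> frontier S"
    using connected_Int_frontier[of "closed_segment a w" S] assms by fastforce
  have "infdist a (frontier S) \<le> dist a y" by (rule infdist_le[OF y(2)])
  also have "\<dots> \<le> dist a w"
    using dist_in_closed_segment[OF y(1)] by (simp add: dist_commute)
  finally show ?thesis .
qed

text \<open>The omitted value \<open>v\<close> is the boundary value at -1. A preimage of the real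
  number \<open>v\<close> would be real, as the function is injective and commutes with conjugation;
  but on (-1,1) it exceeds its value at -1.\<close>

lemma extremal_infdist: "infdist (extremal 0) (frontier (extremal ` unit_disc)) \<le> 1 - ln 2"
proof -
  define v where "v = complex_of_real (ln 2 - 1)"
  have inj: "inj_on extremal unit_disc"
    using class_C1_product[OF extremal_in_class_C1] by metis
  have "v \<notin> extremal ` unit_disc"
  proof
    assume "v \<in> extremal ` unit_disc"
    then obtain z where z: "norm z < 1" "extremal z = v" by auto
    have "1 - z \<notin> \<real>\<^sub>\<le>\<^sub>0"
      using z(1) complex_Re_le_cmod[of z] by (auto simp: complex_nonpos_Reals_iff)
    then have "extremal (cnj z) = cnj (extremal z)"
      using cnj_Ln[of "1 - z"] by (simp add: extremal_def)
    also have "\<dots> = extremal z" by (simp add: z(2) v_def)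
    finally have "cnj z = z" using inj_onD[OF inj, of "cnj z" z] z(1) by simp
    then obtain x where x: "z = of_real x" by (metis Reals_cnj_iff Reals_cases)
    then have x1: "\<bar>x\<bar> < 1" using z(1) by simp
    then have "extremal_real x = ln 2 - 1"
      using z(2) extremal_of_real[of x] unfolding x v_def by (metis abs_less_iff of_real_eq_iff)
    moreover have "extremal_real (-1) < extremal_real x"
      using x1 by (intro extremal_real_strict_mono) auto
    ultimately show False by (simp add: extremal_real_def)
  qed
  then have "infdist (extremal 0) (frontier (extremal ` unit_disc)) \<le> dist (extremal 0) v"
    by (intro infdist_frontier_le) auto
  also have "\<dots> = \<bar>ln 2 - 1\<bar>" by (simp add: extremal_def v_def dist_norm norm_minus_commute del: of_real_diff)
  also have "\<dots> = 1 - ln 2" using ln_2_less_1 by simp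
  finally show ?thesis .
qed

text \<open>The coefficients are nonnegative, so at a point r \<ge> 0 taking moduli changes nothing
  and every estimate behind the majorant is an equality.\<close>

lemma bohr_sum_extremal:
  assumes r: "0 \<le> r" "r < 1"
  shows "bohr_sum extremal (of_real r) = bohr_majorant r"
proof -
  have "extremal has_fps_expansion Abs_fps (\<lambda>n. of_real (extremal_coeff n))"
    using eventually_nhds_in_open[of unit_disc 0]
    by (intro has_fps_expansionI) (auto elim!: eventually_mono intro: extremal_sums)
  then have coeff: "taylor_coeff extremal n = of_real (extremal_coeff n)" for n
    by (simp add: taylor_coeff_def fps_expansion_eqI)
  have "extremal_real r \<ge> 0"
    using extremal_coeff_nonneg r by (intro sums_le[OF _ sums_zero extremal_real_sums[OF r]]) auto
  then have 1: "norm (extremal (of_real r)) = extremal_real r"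
    using r by (simp add: extremal_of_real)
  have "deriv extremal (of_real r) = of_real ((1 + r) / (1 - r)\<^sup>2)"
    using r by (simp add: deriv_extremal)
  then have 2: "norm (deriv extremal (of_real r)) = (1 + r) / (1 - r)\<^sup>2"
    using r by (simp only: norm_of_real) simp
  have "norm (taylor_coeff extremal (n + 2) * of_real r ^ (n + 2)) = extremal_coeff (n + 2) * r ^ (n + 2)" for n
    using r extremal_coeff_nonneg[of "n + 2"] by (simp add: coeff norm_mult norm_power)
  then have 3: "(\<Sum>n. norm (taylor_coeff extremal (n + 2) * of_real r ^ (n + 2))) = extremal_real r - r"
    using extremal_real_tail_sums[OF r] by (simp add: sums_iff)
  show ?thesis unfolding bohr_sum_def 1 2 3 using r by (simp add: bohr_majorant_def mult.commute)
qed

section \<open>The sharp Bohr radius: majorant against covering radius\<close>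

theorem theorem2p3:
  shows "\<exists>r11::real.
    0 < r11 \<and> r11 < 1 \<and> r11_equation r11 \<and>
    (\<forall>r. 0 < r \<and> r < 1 \<and> r11_equation r \<longrightarrow> r = r11) \<and>
    \<bar>r11 - 0.110377\<bar> < 0.0000005 \<and>
    (\<forall>f\<in>class_C1. \<forall>z. norm z \<le> r11 \<longrightarrow>
       bohr_sum f z \<le> infdist (f 0) (frontier (f ` unit_disc))) \<and>
    (\<forall>R>r11. \<not> (\<forall>f\<in>class_C1. \<forall>z\<in>unit_disc. norm z \<le> R \<longrightarrow>
       bohr_sum f z \<le> infdist (f 0) (frontier (f ` unit_disc))))"
proof -
  obtain \<rho> where \<rho>: "0 < \<rho>" "\<rho> < 1" "r11_equation \<rho>" "\<bar>\<rho> - 0.110377\<bar> < 0.0000005"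
    by (rule r11_exists)
  have B\<rho>: "bohr_majorant \<rho> = 1 - ln 2" using \<rho> r11_equation_iff by blast
  have unique: "r = \<rho>" if "0 < r" "r < 1" "r11_equation r" for r
    using that \<rho>(1,2) B\<rho> r11_equation_iff[of r] bohr_majorant_strict_mono[of r \<rho>]
      bohr_majorant_strict_mono[of \<rho> r] by (cases r \<rho> rule: linorder_cases) auto
  have upper: "bohr_sum f z \<le> infdist (f 0) (frontier (f ` unit_disc))"
    if f: "f \<in> class_C1" and z: "norm z \<le> \<rho>" for f z
  proof -
    have "bohr_sum f z \<le> bohr_majorant (norm z)"
      using z \<rho>(2) by (intro bohr_sum_le[OF f]) simp
    also have "\<dots> \<le> bohr_majorant \<rho>"
      using bohr_majorant_strict_mono[of "norm z" \<rho>] z \<rho>(2) by (cases "norm z = \<rho>") auto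
    also have "\<dots> = 1 - ln 2" by (rule B\<rho>)
    also have "\<dots> \<le> infdist (f 0) (frontier (f ` unit_disc))"
    proof (rule covering_radius)
      show "f holomorphic_on unit_disc" "f 0 = 0" using f by (auto simp: class_C1_def)
      show "inj_on f unit_disc" using class_C1_product[OF f] by metis
    qed (rule class_C1_distortion(1)[OF f])
    finally show ?thesis .
  qed
  have sharp: "\<exists>f\<in>class_C1. \<exists>z\<in>unit_disc. norm z \<le> R \<and>
       \<not> bohr_sum f z \<le> infdist (f 0) (frontier (f ` unit_disc))" if R: "R > \<rho>" for R
  proof -
    \<comment> \<open>As \<open>R\<close> may be 1 or larger, the minimum with the midpoint of
      \<rho> and 1 gives a radius strictly between \<rho> and 1 that is at most
      \<open>R\<close>.\<close>
    define r where "r = min R ((1 + \<rho>) / 2)"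
    have "r \<le> (1 + \<rho>) / 2" unfolding r_def by (rule min.cobounded2)
    moreover have "\<rho> < r" "r \<le> R" using R \<rho>(2) by (auto simp: r_def)
    ultimately have r: "\<rho> < r" "r < 1" "r \<le> R" using \<rho>(2) by auto
    have "bohr_sum extremal (of_real r) = bohr_majorant r"
      using r \<rho> by (intro bohr_sum_extremal) auto
    moreover have "bohr_majorant r > 1 - ln 2"
      using bohr_majorant_strict_mono[of \<rho> r] r \<rho> B\<rho> by simp
    ultimately have "\<not> bohr_sum extremal (of_real r) \<le> infdist (extremal 0) (frontier (extremal ` unit_disc))"
      using extremal_infdist by linarith
    moreover have "norm (complex_of_real r) = r" using r \<rho> by simp
    ultimately show ?thesis
      using r extremal_in_class_C1 by (intro bexI[of _ extremal] bexI[of _ "of_real r"]) auto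
  qed
  show ?thesis
  proof (intro exI[of _ \<rho>] conjI)
    show "\<forall>r. 0 < r \<and> r < 1 \<and> r11_equation r \<longrightarrow> r = \<rho>"
      using unique by blast
    show "\<forall>f\<in>class_C1. \<forall>z. norm z \<le> \<rho> \<longrightarrow>
        bohr_sum f z \<le> infdist (f 0) (frontier (f ` unit_disc))"
      using upper by blast
    show "\<forall>R>\<rho>. \<not> (\<forall>f\<in>class_C1. \<forall>z\<in>unit_disc. norm z \<le> R \<longrightarrow>
        bohr_sum f z \<le> infdist (f 0) (frontier (f ` unit_disc)))"
      using sharp by blast
  qed (rule \<rho>)+
qed

end
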